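(* Let $D=(D_T,D_F)$ be an $(s^{n-k}:s^p)$ RME design. Suppose that $D_T$ has minimum aberration (MA) among all regular $s^{n-k}$ designs and that $$A_{2,1}(D)=[2(s-1)]^{-1}\Big\{-n(n+s-1)+s^{-(n-k-p-2)}\big[n^2+(s^{n-k-p}-1)\big(J^2+\eta(1-\eta)\big)\big]\Big\},$$ where $J=n(s^{n-k-p-1}-1)(s^{n-k-p}-1)^{-1}$ and $\eta$ is the fractional part of $J$. Then $D$ has MA with respect to each of $W_{\mathrm{scf}}$, $W_1$, $W_2$ and $W_{\mathrm{cc}}$.
   Context: Let $s$ be a prime power, $GF(s)$ the field with $s$ elements, and $V_m$ the space of row vectors of length $m$ over $GF(s)$. Let $n,k,p$ be integers with $n\ge1$, $k\ge0$, $n-k\ge 1$, $p\ge 1$; write $N=s^{n-k}$ and $L_q=(s^q-1)/(s-1)$. Designs. A regular $s^{n-k}$ design is the $N\times n$ matrix $D_T$ whose rows are the vectors $uT$, $u\in V_{n-k}$, where $T$ is an $(n-k)\times n$ matrix over $GF(s)$ of full row rank. A regular $(s^{n-k}:s^p)$ design $D$ is specified by such a $T$ together with an $(n-k)\times p$ matrix $B$ over $GF(s)$ of full column rank; its blocks are the sets $\{uT: u\in V_{n-k},\,uB=v\}$, one for each $v\in V_p$. If $b_1,\dots,b_p$ are the columns of $B$, let $F$ be the $(n-k)\times L_p$ matrix whose columns are all combinations $\lambda_1b_1+\cdots+\lambda_pb_p$ with $\lambda_i\in GF(s)$, not all zero, the first nonzero $\lambda_i$ being $1$. Let $D_F$ be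 the $N\times L_p$ matrix with rows $uF$, $u\in V_{n-k}$ (same ordering of $u$ as in $D_T$). One writes $D=(D_T,D_F)$. Wordlength patterns. Let $wt$ denote the Hamming weight. $A_{i,0}=(s-1)^{-1}\#\{w\in V_n: Tw'=0,\ wt(w)=i\}$ and $A_{i,1}=(s-1)^{-1}\#\{(w_1,w_2)\in V_n\times V_{L_p}: Tw_1'+Fw_2'=0,\ wt(w_1)=i,\ wt(w_2)=1\}$ (both are $0$ for $i>n$). $D$ is a regular main effect (RME) design if $A_{1,0}(D)=A_{2,0}(D)=A_{1,1}(D)=0$. (This forces $p\le n-k-1$.) Minimum aberration. A regular $s^{n-k}$ design has MA among a class of regular $s^{n-k}$ designs if it sequentially (i.e. lexicographically) minimizes $A_{1,0},A_{2,0},\dots,A_{n,0}$ over the class. For blocked designs, consider the sequences $W_{\mathrm{scf}}=(A_{3,0},A_{2,1},A_{4,0},A_{3,1},A_{5,0},A_{4,1},\dots)$ (successive pairs $A_{i+1,0},A_{i,1}$, $i=2,3,\dots$); $W_{\mathrm{cc}}=(3A_{3,0}+A_{2,1},A_{4,0},10A_{5,0}+A_{3,1},A_{6,0},\dots)$ (successive pairs $\binom{2i-1}{i}A_{2i-1,0}+A_{i,1},\ A_{2i,0}$, $i=2,3,\dots$); $W_1=(A_{3,0},A_{4,0},A_{2,1},A_{5,0},A_{6,0},A_{3,1},\dots)$ (successive triples $A_{2i-1,0},A_{2i,0},A_{i,1}$, $i=2,3,\dots$); $W_2=(A_{3,0},A_{2,1},A_{4,0},A_{5,0},A_{3,1},A_{6,0},\dots)$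 (successive triples $A_{2i-1,0},A_{i,1},A_{2i,0}$, $i=2,3,\dots$). An $(s^{n-k}:s^p)$ RME design has MA with respect to one of these sequences $W$ if it lexicographically minimizes $W$ among all $(s^{n-k}:s^p)$ RME designs (same $s,n,k,p$). *)

theory Defs
  imports
    Complex_Main
    "HOL-Library.Cardinality"
    "HOL-Library.Fun_Lexorder"
    "Jordan_Normal_Form.DL_Rank"
begin

text \<open>
  The field $GF(s)$ is a type \<open>'a :: {field, finite}\<close> with \<open>s = CARD('a)\<close>. A regular $s^{n-k}$
  design, whose runs are the vectors $uT$, is given by its defining matrix \<open>T\<close>; a regular
  $(s^{n-k}:s^p)$ design, with blocks $\{uT : uB = v\}$, by the pair \<open>T\<close>, \<open>B\<close>.
\<close>

definition regular_design :: "nat \<Rightarrow> nat \<Rightarrow> 'a::{field,finite} mat \<Rightarrow> bool" where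
  "regular_design n k T \<longleftrightarrow> T \<in> carrier_mat (n - k) n \<and> vec_space.rank (n - k) T = n - k"

definition regular_blocked_design ::
    "nat \<Rightarrow> nat \<Rightarrow> nat \<Rightarrow> 'a::{field,finite} mat \<Rightarrow> 'a mat \<Rightarrow> bool" where
  "regular_blocked_design n k p T B \<longleftrightarrow>
     regular_design n k T \<and> B \<in> carrier_mat (n - k) p \<and> vec_space.rank (n - k) B = p"

definition normalized_vecs :: "nat \<Rightarrow> 'a::{field,finite} vec set" where
  "normalized_vecs p = {l \<in> carrier_vec p. \<exists>i<p. l $ i = 1 \<and> (\<forall>j<i. l $ j = 0)}"

text \<open>
  The matrix $F$. The order of its columns is an arbitrary fixed enumeration of the normalized
  coefficient vectors; nothing below depends on that choice.
\<close>

definition block_matrix :: "'a::{field,finite} mat \<Rightarrow> 'a mat" where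
  "block_matrix B = mat_of_cols (dim_row B)
     (map (\<lambda>l. B *\<^sub>v l)
       (SOME ls. distinct ls \<and> set ls = (normalized_vecs (dim_col B) :: 'a vec set)))"

definition wt :: "'a::zero vec \<Rightarrow> nat" where
  "wt w = card {i. i < dim_vec w \<and> w $ i \<noteq> 0}"

definition A0 :: "'a::{field,finite} mat \<Rightarrow> nat \<Rightarrow> real" where
  "A0 T i = real (card {w \<in> carrier_vec (dim_col T). T *\<^sub>v w = 0\<^sub>v (dim_row T) \<and> wt w = i})
              / (real CARD('a) - 1)"

definition A1 :: "'a::{field,finite} mat \<Rightarrow> 'a mat \<Rightarrow> nat \<Rightarrow> real" where
  "A1 T B i = (let F = block_matrix B in
     real (card {(w1, w2). w1 \<in> carrier_vec (dim_col T) \<and> w2 \<in> carrier_vec (dim_col F) \<and>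
                    T *\<^sub>v w1 + F *\<^sub>v w2 = 0\<^sub>v (dim_row T) \<and> wt w1 = i \<and> wt w2 = 1})
       / (real CARD('a) - 1))"

definition RME :: "nat \<Rightarrow> nat \<Rightarrow> nat \<Rightarrow> 'a::{field,finite} mat \<Rightarrow> 'a mat \<Rightarrow> bool" where
  "RME n k p T B \<longleftrightarrow>
     regular_blocked_design n k p T B \<and> A0 T 1 = 0 \<and> A0 T 2 = 0 \<and> A1 T B 1 = 0"

definition lex_le :: "(nat \<Rightarrow> real) \<Rightarrow> (nat \<Rightarrow> real) \<Rightarrow> bool" where
  "lex_le f g \<longleftrightarrow> f = g \<or> less_fun f g"

text \<open>
  All sequences below are infinite and indexed from \<open>0\<close>; \<open>A0 T i\<close> and \<open>A1 T B i\<close> vanish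
  for \<open>i > dim_col T\<close>, so the tails do not affect the comparisons.
\<close>

definition MA_unblocked :: "nat \<Rightarrow> nat \<Rightarrow> 'a::{field,finite} mat \<Rightarrow> bool" where
  "MA_unblocked n k T \<longleftrightarrow> regular_design n k T \<and>
     (\<forall>T' :: 'a mat. regular_design n k T' \<longrightarrow>
        lex_le (\<lambda>i. A0 T (Suc i)) (\<lambda>i. A0 T' (Suc i)))"

text \<open>In the following, \<open>a i\<close> stands for $A_{i,0}$ and \<open>b i\<close> for $A_{i,1}$.\<close>

definition W_scf :: "(nat \<Rightarrow> real) \<Rightarrow> (nat \<Rightarrow> real) \<Rightarrow> nat \<Rightarrow> real" where
  "W_scf a b m = (let i = m div 2 + 2 in if m mod 2 = 0 then a (i + 1) else b i)"

definition W_cc :: "(nat \<Rightarrow> real) \<Rightarrow> (nat \<Rightarrow> real) \<Rightarrow> nat \<Rightarrow> real" where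
  "W_cc a b m = (let i = m div 2 + 2 in
     if m mod 2 = 0 then real ((2 * i - 1) choose i) * a (2 * i - 1) + b i else a (2 * i))"

definition W_1 :: "(nat \<Rightarrow> real) \<Rightarrow> (nat \<Rightarrow> real) \<Rightarrow> nat \<Rightarrow> real" where
  "W_1 a b m = (let i = m div 3 + 2 in
     if m mod 3 = 0 then a (2 * i - 1) else if m mod 3 = 1 then a (2 * i) else b i)"

definition W_2 :: "(nat \<Rightarrow> real) \<Rightarrow> (nat \<Rightarrow> real) \<Rightarrow> nat \<Rightarrow> real" where
  "W_2 a b m = (let i = m div 3 + 2 in
     if m mod 3 = 0 then a (2 * i - 1) else if m mod 3 = 1 then b i else a (2 * i))"

definition MA_blocked :: "((nat \<Rightarrow> real) \<Rightarrow> (nat \<Rightarrow> real) \<Rightarrow> nat \<Rightarrow> real) \<Rightarrow>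
    nat \<Rightarrow> nat \<Rightarrow> nat \<Rightarrow> 'a::{field,finite} mat \<Rightarrow> 'a mat \<Rightarrow> bool" where
  "MA_blocked W n k p T B \<longleftrightarrow> RME n k p T B \<and>
     (\<forall>T' B' :: 'a mat. RME n k p T' B' \<longrightarrow>
        lex_le (W (A0 T) (A1 T B)) (W (A0 T') (A1 T' B')))"

lemma bij_betw_lists_carrier_vec:
  "bij_betw vec_of_list {xs :: 'a list. length xs = n} (carrier_vec n)"
proof (rule bij_betw_byWitness[where f' = list_of_vec])
  show "vec_of_list ` {xs :: 'a list. length xs = n} \<subseteq> carrier_vec n"
    by (rule image_subsetI, rule carrier_vecI) simp
  show "list_of_vec ` carrier_vec n \<subseteq> {xs :: 'a list. length xs = n}"
    by (rule image_subsetI) simp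
qed (blast intro: list_vec vec_list)+

lemma finite_carrier_vec: "finite (carrier_vec n :: 'a::finite vec set)"
  using bij_betw_finite[OF bij_betw_lists_carrier_vec[of n, where 'a = 'a]]
    finite_lists_length_eq[of "UNIV :: 'a set" n] by simp

lemma card_carrier_vec: "card (carrier_vec n :: 'a::finite vec set) = CARD('a) ^ n"
  using bij_betw_same_card[OF bij_betw_lists_carrier_vec[of n, where 'a = 'a]]
    card_lists_length_eq[of "UNIV :: 'a set" n] by simp

lemma finite_normalized_vecs: "finite (normalized_vecs p :: 'a::{field,finite} vec set)"
  by (rule finite_subset[OF _ finite_carrier_vec]) (auto simp: normalized_vecs_def)

lemma card_normalized_vecs:
  "(CARD('a) - 1) * card (normalized_vecs p :: 'a::{field,finite} vec set) = CARD('a) ^ p - 1"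
proof -
  let ?N = "normalized_vecs p :: 'a vec set"
  let ?X = "(UNIV - {0 :: 'a}) \<times> ?N"
  let ?Y = "carrier_vec p - {0\<^sub>v p :: 'a vec}"
  have inj: "inj_on (\<lambda>(c, l). c \<cdot>\<^sub>v l) ?X"
  proof (rule inj_onI)
    fix x y assume x: "x \<in> ?X" and y: "y \<in> ?X"
      and xy: "(\<lambda>(c, l). c \<cdot>\<^sub>v l) x = (\<lambda>(c, l). c \<cdot>\<^sub>v l) y"
    obtain c l where xe: "x = (c, l)" by (cases x)
    obtain d m where ye: "y = (d, m)" by (cases y)
    have c: "c \<noteq> 0" "d \<noteq> 0" and l: "l \<in> ?N" and m: "m \<in> ?N"
      and eq: "c \<cdot>\<^sub>v l = d \<cdot>\<^sub>v m"
      using x y xy xe ye by auto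
    from l obtain i where i: "i < p" "l $ i = 1" "\<forall>j<i. l $ j = 0" and lc: "l \<in> carrier_vec p"
      unfolding normalized_vecs_def by auto
    from m obtain i' where i': "i' < p" "m $ i' = 1" "\<forall>j<i'. m $ j = 0" and mc: "m \<in> carrier_vec p"
      unfolding normalized_vecs_def by auto
    have e: "c * l $ j = d * m $ j" if "j < p" for j
      using arg_cong[OF eq, of "\<lambda>v. v $ j"] that lc mc by simp
    have ii: "i = i'"
    proof (rule ccontr)
      assume "i \<noteq> i'"
      then consider "i < i'" | "i' < i" by linarith
      then show False
        using e[OF i(1)] e[OF i'(1)] i(2,3) i'(2,3) c by cases simp_all
    qed
    have cd: "c = d" using e[OF i(1)] i(2) i'(2) unfolding ii by simp
    have lm: "l $ j = m $ j" if "j < p" for j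
      using e[OF that] c(1) unfolding cd[symmetric] by simp
    have "l = m" by (rule eq_vecI) (use lm lc mc in simp_all)
    with cd xe ye show "x = y" by simp
  qed
  have "(\<lambda>(c, l). c \<cdot>\<^sub>v l) ` ?X = ?Y"
  proof (intro equalityI subsetI)
    fix v assume "v \<in> (\<lambda>(c, l). c \<cdot>\<^sub>v l) ` ?X"
    then obtain c l where v: "v = c \<cdot>\<^sub>v l" "c \<noteq> 0" "l \<in> ?N" by auto
    from v(3) obtain i where i: "i < p" "l $ i = 1" and lc: "l \<in> carrier_vec p"
      unfolding normalized_vecs_def by auto
    then have "v $ i \<noteq> 0\<^sub>v p $ i" using v by simp
    then show "v \<in> ?Y" using v lc by auto
  next
    fix v assume v: "v \<in> ?Y"
    then have vc: "v \<in> carrier_vec p" by simp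
    have "\<exists>i. i < p \<and> v $ i \<noteq> 0"
    proof (rule ccontr)
      assume "\<not> ?thesis"
      then have "v = 0\<^sub>v p" using vc by (intro eq_vecI) auto
      with v show False by simp
    qed
    then obtain i where i: "i < p" "v $ i \<noteq> 0" and m: "\<forall>j<i. \<not> (j < p \<and> v $ j \<noteq> 0)"
      using exists_least_iff[of "\<lambda>i. i < p \<and> v $ i \<noteq> 0"] by auto
    have "inverse (v $ i) \<cdot>\<^sub>v v \<in> ?N"
      unfolding normalized_vecs_def using i m vc by (auto intro!: exI[of _ i])
    moreover have "v = v $ i \<cdot>\<^sub>v (inverse (v $ i) \<cdot>\<^sub>v v)"
      using i by (simp add: smult_smult_assoc)
    ultimately show "v \<in> (\<lambda>(c, l). c \<cdot>\<^sub>v l) ` ?X"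
      using i(2) by (intro image_eqI[of _ _ "(v $ i, inverse (v $ i) \<cdot>\<^sub>v v)"]) simp_all
  qed
  then have "card ?X = card ?Y" using card_image[OF inj] by simp
  then show ?thesis
    by (simp add: card_cartesian_product card_Diff_singleton finite_carrier_vec card_carrier_vec)
qed

text \<open>The matrix $F$ has $L_p = (s^p-1)/(s-1)$ columns.\<close>

lemma dim_col_block_matrix:
  fixes B :: "'a::{field,finite} mat"
  shows "dim_col (block_matrix B) = (CARD('a) ^ dim_col B - 1) div (CARD('a) - 1)"
proof -
  let ?N = "normalized_vecs (dim_col B) :: 'a vec set"
  let ?ls = "SOME ls. distinct ls \<and> set ls = ?N"
  have "distinct ?ls \<and> set ?ls = ?N"
    by (rule someI_ex) (use finite_distinct_list[OF finite_normalized_vecs] in blast)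
  then have "dim_col (block_matrix B) = card ?N"
    unfolding block_matrix_def using distinct_card[of ?ls] by simp
  moreover have "CARD('a) - 1 \<noteq> 0"
    using card_mono[of "UNIV :: 'a set" "{0, 1}"] by simp
  ultimately show ?thesis
    unfolding card_normalized_vecs[where 'a = 'a, of "dim_col B", symmetric] by simp
qed

end

theory Submission
  imports Defs
begin

text \<open>
  Call \<open>A\<^sub>i = A\<^bsub>i,0\<^esub> + A\<^bsub>i,1\<^esub>\<close> the total wordlength counts of a blocked design. Up to the factor \<open>s - 1\<close>,
  \<open>A\<^sub>i\<close> counts the words \<open>w\<close> of weight \<open>i\<close> for which \<open>T w\<close> lies in the column space \<open>C\<close> of \<open>B\<close>
  (\<open>A0_plus_A1_eq\<close>): the summand \<open>A\<^bsub>i,0\<^esub>\<close> has \<open>T w = 0\<close>, and \<open>A\<^bsub>i,1\<^esub>\<close> has \<open>T w\<close> in \<open>C - {0}\<close>, because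
  the columns of \<open>F\<close> represent the lines of \<open>C\<close>. These words form the dual of the principal block, which
  consists of the runs \<open>u T\<close> with \<open>u\<close> in the dual code \<open>U\<close> of \<open>C\<close> and has \<open>s\<^sup>m\<close> runs, \<open>m = n - k - p\<close>.
  By the MacWilliams identity (\<open>MacWilliams_identity\<close>) all \<open>A\<^sub>i\<close> are therefore functions of the
  multiset of the numbers \<open>z u\<close> of zero coordinates of \<open>u T\<close>, for \<open>u\<close> in \<open>U\<close>.

  For an RME design \<open>A\<^sub>1 = 0\<close>, and this fixes the mean of \<open>z u\<close> over the nonzero \<open>u\<close> of \<open>U\<close>: it is the number
  \<open>J\<close> of the theorem. Moreover \<open>A\<^sub>2 = A\<^bsub>2,1\<^esub>\<close> is an increasing affine function of the sum of the
  squares of the \<open>z u\<close>. As the \<open>z u\<close> are integers with mean \<open>J\<close>, this sum is least exactly when each of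
  them is \<open>\<lfloor>J\<rfloor>\<close> or \<open>\<lfloor>J\<rfloor> + 1\<close>, and the least value gives the assumed value of \<open>A\<^bsub>2,1\<^esub>\<close>. Hence this value is a lower
  bound for every RME design (\<open>A21_lower_bound\<close>). Equality leaves no freedom: how often each of the
  two integers occurs follows from the mean, so two designs that attain the bound have the same
  \<open>A\<^sub>i\<close> for every \<open>i\<close> (\<open>A0_plus_A1_determined_if_A21_minimal\<close>).

  The rest is lexicographic bookkeeping (locale \<open>wordlength_comparison\<close>). In each of the four sequences every
  \<open>A\<^bsub>i,1\<^esub>\<close> with \<open>i > 2\<close> comes after both \<open>A\<^bsub>2,1\<^esub>\<close> and \<open>A\<^bsub>i,0\<^esub>\<close>. A competitor that ties with the given
  design in all entries before \<open>A\<^bsub>i,1\<^esub>\<close> attains the bound too, so for both designs \<open>A\<^bsub>i,1\<^esub>\<close> is the same constant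
  minus the same \<open>A\<^bsub>i,0\<^esub>\<close> and cannot decide the comparison. What decides it is \<open>A\<^bsub>2,1\<^esub>\<close>, which is minimal, or
  some \<open>A\<^bsub>i,0\<^esub>\<close>, which is minimal given the earlier ones because \<open>T\<close> has minimum aberration, or, at the
  start of \<open>W_cc\<close>, a sum of two such numbers.
\<close>

section \<open>Character sums over a finite field\<close>

lemma CARD_field_gt_1: "1 < CARD('a::{field,finite})"
  using card_mono[of "UNIV :: 'a set" "{0, 1}"] by simp

text \<open>
  The sum of \<open>\<chi> x\<close> over the nontrivial additive characters \<open>\<chi>\<close> of the field. Working with this
  integer instead of single characters keeps everything real, at the price of multiplicativity.
  The orthogonality of characters becomes the vanishing of the sum of \<open>char_sum\<close> over the field.
\<close>

definition char_sum :: "'a::{field,finite} \<Rightarrow> real" where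
  "char_sum x = (if x = 0 then real CARD('a) - 1 else - 1)"

lemma char_sum_0 [simp]: "char_sum (0 :: 'a::{field,finite}) = real CARD('a) - 1"
  by (simp add: char_sum_def)

lemma sum_char_sum_UNIV: "(\<Sum>x\<in>(UNIV :: 'a::{field,finite} set). char_sum x) = 0"
proof -
  have "(\<Sum>x\<in>(UNIV :: 'a set). char_sum x) = char_sum (0::'a) + (\<Sum>x\<in>UNIV - {0 :: 'a}. - 1)"
    by (subst sum.remove[of _ 0]) (auto simp: char_sum_def)
  moreover have "1 \<le> CARD('a)" by (simp add: Suc_leI)
  ultimately show ?thesis
    by (simp add: char_sum_def card_Diff_singleton of_nat_diff)
qed

lemma sum_char_sum_affine:
  fixes c d :: "'a::{field,finite}"
  assumes "c \<noteq> 0"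
  shows "(\<Sum>x\<in>UNIV. char_sum (c * x + d)) = 0"
proof -
  have "bij (\<lambda>x. c * x + d)"
    by (rule o_bij[where g = "\<lambda>y. (y - d) / c"]) (auto simp: assms)
  from sum.reindex_bij_betw[OF this, of char_sum] show ?thesis
    by (simp add: sum_char_sum_UNIV)
qed

lemma wt_vCons: "wt (vCons x w) = (if x = 0 then 0 else 1) + wt w"
proof -
  let ?S = "{i. i < dim_vec w \<and> w $ i \<noteq> 0}"
  have "{i. i < dim_vec (vCons x w) \<and> vCons x w $ i \<noteq> 0} = (if x = 0 then {} else {0}) \<union> Suc ` ?S"
  proof (rule Set.set_eqI)
    fix i
    show "(i \<in> {i. i < dim_vec (vCons x w) \<and> vCons x w $ i \<noteq> 0})
      = (i \<in> (if x = 0 then {} else {0}) \<union> Suc ` ?S)"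
      by (cases i) auto
  qed
  moreover have "card (Suc ` ?S) = card ?S" by (simp add: card_image)
  ultimately show ?thesis unfolding wt_def by auto
qed

lemma wt_le_dim: "wt w \<le> dim_vec w"
proof -
  have "wt w \<le> card {..<dim_vec w}" unfolding wt_def by (rule card_mono) auto
  then show ?thesis by simp
qed

lemma sum_carrier_vec_Suc:
  fixes f :: "'a::finite vec \<Rightarrow> 'b::comm_monoid_add"
  shows "(\<Sum>w\<in>carrier_vec (Suc n). f w) = (\<Sum>x\<in>UNIV. \<Sum>w\<in>carrier_vec n. f (vCons x w))"
proof -
  have "bij_betw (\<lambda>(x, w). vCons x w) (UNIV \<times> carrier_vec n) (carrier_vec (Suc n) :: 'a vec set)"
  proof (rule bij_betw_imageI)
    show "(\<lambda>(x, w). vCons x w) ` (UNIV \<times> carrier_vec n) = (carrier_vec (Suc n) :: 'a vec set)"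
    proof (intro equalityI subsetI)
      fix v :: "'a vec" assume v: "v \<in> carrier_vec (Suc n)"
      show "v \<in> (\<lambda>(x, w). vCons x w) ` (UNIV \<times> carrier_vec n)"
        by (rule vec_cases[of v]) (use v in \<open>auto intro!: image_eqI\<close>)
    qed auto
  qed (auto simp: inj_on_def)
  from sum.reindex_bij_betw[OF this, of f, symmetric] show ?thesis
    by (simp add: sum.cartesian_product case_prod_unfold)
qed

section \<open>The MacWilliams identity\<close>

text \<open>
  The generating function of the Krawtchouk polynomials at \<open>n - z\<close>, where \<open>z\<close> counts the zero
  coordinates of a vector of length \<open>n\<close>. Zeros rather than weights are the natural argument here, since
  the quantity \<open>J\<close> of the theorem is a mean number of zeros.
\<close>

definition krawtchouk_poly :: "real \<Rightarrow> nat \<Rightarrow> nat \<Rightarrow> real poly" where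
  "krawtchouk_poly s n z = [:1, -1:] ^ (n - z) * [:1, s - 1:] ^ z"

lemma coeff_linear_power_12:
  fixes c :: real
  shows "coeff ([:1, c:] ^ n) 0 = 1" "coeff ([:1, c:] ^ n) 1 = real n * c"
    "coeff ([:1, c:] ^ n) 2 = real n * (real n - 1) / 2 * c ^ 2"
proof -
  have "coeff ([:1, c:] ^ n) 0 = 1 \<and> coeff ([:1, c:] ^ n) 1 = real n * c \<and>
    coeff ([:1, c:] ^ n) 2 = real n * (real n - 1) / 2 * c ^ 2"
    by (induction n) (auto simp: numeral_2_eq_2 field_simps)
  then show "coeff ([:1, c:] ^ n) 0 = 1" "coeff ([:1, c:] ^ n) 1 = real n * c"
    "coeff ([:1, c:] ^ n) 2 = real n * (real n - 1) / 2 * c ^ 2"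
    by blast+
qed

lemma coeff_krawtchouk_poly:
  assumes "z \<le> n"
  shows "coeff (krawtchouk_poly s n z) 1 = s * real z - real n"
    and "coeff (krawtchouk_poly s n z) 2
      = ((s * real z - real n) ^ 2 - s * (s - 2) * real z - real n) / 2"
proof -
  have nz: "real (n - z) = real n - real z" using assms by simp
  have "{..1::nat} = {0, 1}" "{..2::nat} = {0, 1, 2}" by auto
  then have "coeff (p * q) 1 = coeff p 0 * coeff q 1 + coeff p 1 * coeff q 0"
    "coeff (p * q) 2 = coeff p 0 * coeff q 2 + coeff p 1 * coeff q 1 + coeff p 2 * coeff q 0"
    for p q :: "real poly"
    by (simp_all only: coeff_mult) simp_all
  note expand = krawtchouk_poly_def this coeff_linear_power_12 nz
  show "coeff (krawtchouk_poly s n z) 1 = s * real z - real n"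
    unfolding expand by (simp add: algebra_simps)
  show "coeff (krawtchouk_poly s n z) 2
      = ((s * real z - real n) ^ 2 - s * (s - 2) * real z - real n) / 2"
    unfolding expand by (simp add: field_simps power2_eq_square)
qed

text \<open>
  Character sums usually factor over the coordinates, but \<open>char_sum\<close> is not multiplicative. The
  shift \<open>d\<close> replaces multiplicativity: it absorbs the first coordinate \<open>x\<close> into \<open>d + a x\<close>, and the
  induction goes through for all shifts at once. A coordinate with \<open>a = 0\<close> contributes the factor
  \<open>1 + (s - 1) X\<close>, one with \<open>a \<noteq> 0\<close> the factor \<open>1 - X\<close>, as the terms for \<open>x \<noteq> 0\<close> sum to \<open>- char_sum d\<close>.
\<close>

theorem weight_enumerator_char_sum:
  fixes c :: "'a::{field,finite} vec"
  assumes "c \<in> carrier_vec n"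
  shows "(\<Sum>w\<in>carrier_vec n. monom (char_sum (c \<bullet> w + d)) (wt w))
    = Polynomial.smult (char_sum d) (krawtchouk_poly (real CARD('a)) n (n - wt c))"
  using assms
proof (induction n c arbitrary: d rule: carrier_vec_induct)
  case 0
  have "carrier_vec 0 = {vNil :: 'a vec}" by (auto intro: eq_vecI)
  then show ?case
    by (simp add: krawtchouk_poly_def wt_def scalar_prod_def monom_0)
next
  case (Suc n a c)
  let ?s = "real CARD('a)"
  let ?K = "krawtchouk_poly ?s n (n - wt c)"
  define e :: "'a \<Rightarrow> nat" where "e x = (if x = 0 then 0 else 1)" for x
  have "(\<Sum>w\<in>carrier_vec (Suc n). monom (char_sum (vCons a c \<bullet> w + d)) (wt w))
      = (\<Sum>x\<in>UNIV. \<Sum>w\<in>carrier_vec n. monom 1 (e x) * monom (char_sum (c \<bullet> w + (a * x + d))) (wt w))"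
    unfolding sum_carrier_vec_Suc
    by (intro sum.cong refl) (simp add: wt_vCons mult_monom e_def algebra_simps)
  also have "\<dots> = (\<Sum>x\<in>UNIV. monom (char_sum (a * x + d)) (e x)) * ?K"
    by (simp add: sum_distrib_left[symmetric] sum_distrib_right Suc(2) smult_monom
        flip: mult_smult_left)
  also have "(\<Sum>x\<in>UNIV. monom (char_sum (a * x + d)) (e x))
      = monom (char_sum d) 0 + (\<Sum>x\<in>UNIV - {0}. monom (char_sum (a * x + d)) 1)"
    by (subst sum.remove[of _ 0]) (auto simp: e_def intro!: sum.cong)
  also have "\<dots> = [:char_sum d, (\<Sum>x\<in>UNIV - {0}. char_sum (a * x + d)):]"
    unfolding monom_sum[symmetric] by (simp add: monom_0 monom_Suc)
  also have "\<dots> * ?K = Polynomial.smult (char_sum d) (krawtchouk_poly ?s (Suc n) (Suc n - wt (vCons a c)))"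
  proof (cases "a = 0")
    case True
    have "1 \<le> CARD('a)" by (simp add: Suc_leI)
    then have "[:char_sum d, (\<Sum>x\<in>UNIV - {0}. char_sum (a * x + d)):]
        = Polynomial.smult (char_sum d) [:1, ?s - 1:]"
      using True by (simp add: card_Diff_singleton of_nat_diff)
    moreover have "Suc n - wt c = Suc (n - wt c)" "Suc n - Suc (n - wt c) = n - (n - wt c)"
      using wt_le_dim[of c] Suc(1) by auto
    ultimately show ?thesis
      using True by (simp add: krawtchouk_poly_def wt_vCons smult_add_right algebra_simps)
  next
    case False
    have "(\<Sum>x\<in>UNIV - {0}. char_sum (a * x + d)) = - char_sum d"
      using sum_char_sum_affine[OF False, of d] by (subst (asm) sum.remove[of _ 0]) auto
    then have "[:char_sum d, (\<Sum>x\<in>UNIV - {0}. char_sum (a * x + d)):]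
        = Polynomial.smult (char_sum d) [:1, - 1:]" by simp
    moreover have "Suc n - (n - wt c) = Suc (n - (n - wt c))" by auto
    ultimately show ?thesis
      using False by (simp add: krawtchouk_poly_def wt_vCons smult_add_right algebra_simps)
  qed
  finally show ?case .
qed

definition linear_code :: "nat \<Rightarrow> 'a::field vec set \<Rightarrow> bool" where
  "linear_code r S \<longleftrightarrow> S \<subseteq> carrier_vec r \<and> 0\<^sub>v r \<in> S \<and>
     (\<forall>u\<in>S. \<forall>v\<in>S. u + v \<in> S) \<and> (\<forall>c. \<forall>u\<in>S. c \<cdot>\<^sub>v u \<in> S)"

definition dual_code :: "nat \<Rightarrow> 'a::field vec set \<Rightarrow> 'a vec set" where
  "dual_code r S = {v \<in> carrier_vec r. \<forall>u\<in>S. u \<bullet> v = 0}"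

lemma linear_code_dual:
  assumes "S \<subseteq> carrier_vec r"
  shows "linear_code r (dual_code r S)"
  using assms unfolding linear_code_def dual_code_def
  by (auto simp: scalar_prod_add_distrib[of _ r] subset_eq)

lemma linear_code_carrier: "linear_code r (carrier_vec r)"
  unfolding linear_code_def by auto

lemma finite_linear_code:
  fixes S :: "'a::{field,finite} vec set"
  shows "linear_code r S \<Longrightarrow> finite S"
  unfolding linear_code_def by (auto intro: finite_subset finite_carrier_vec)

text \<open>
  If \<open>w\<close> in \<open>S\<close> is not orthogonal to \<open>v\<close>, then translating \<open>u\<close> by the multiples of \<open>w\<close> averages \<open>char_sum\<close>
  over the whole field.
\<close>

lemma sum_char_sum_linear_code:
  fixes S :: "'a::{field,finite} vec set"
  assumes S: "linear_code r S" and v: "v \<in> carrier_vec r"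
  shows "(\<Sum>u\<in>S. char_sum (u \<bullet> v))
    = (if v \<in> dual_code r S then (real CARD('a) - 1) * real (card S) else 0)"
proof (cases "v \<in> dual_code r S")
  case True
  then show ?thesis by (simp add: dual_code_def char_sum_def)
next
  case False
  then obtain w where w: "w \<in> S" "w \<bullet> v \<noteq> 0" using v by (auto simp: dual_code_def)
  have sub: "S \<subseteq> carrier_vec r" and closed: "\<And>x u. u \<in> S \<Longrightarrow> u + x \<cdot>\<^sub>v w \<in> S"
    using S w(1) by (auto simp: linear_code_def)
  have wc: "w \<in> carrier_vec r" using sub w(1) by blast
  have shift: "(\<Sum>u\<in>S. char_sum (u \<bullet> v)) = (\<Sum>u\<in>S. char_sum ((w \<bullet> v) * x + u \<bullet> v))" for x
  proof (rule sum.reindex_bij_witness[where i = "\<lambda>u. u + x \<cdot>\<^sub>v w" and j = "\<lambda>u. u + (- x) \<cdot>\<^sub>v w"])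
    fix u assume u: "u \<in> S"
    then have uc: "u \<in> carrier_vec r" using sub by blast
    show "u + (- x) \<cdot>\<^sub>v w \<in> S" "u + x \<cdot>\<^sub>v w \<in> S" by (rule closed[OF u])+
    show "u + (- x) \<cdot>\<^sub>v w + x \<cdot>\<^sub>v w = u" "u + x \<cdot>\<^sub>v w + (- x) \<cdot>\<^sub>v w = u"
      using uc wc by (auto intro!: eq_vecI)
    show "char_sum ((w \<bullet> v) * x + (u + (- x) \<cdot>\<^sub>v w) \<bullet> v) = char_sum (u \<bullet> v)"
      using uc wc v by (simp add: add_scalar_prod_distrib[of _ r])
  qed
  have "real CARD('a) * (\<Sum>u\<in>S. char_sum (u \<bullet> v)) = (\<Sum>x\<in>(UNIV :: 'a set). \<Sum>u\<in>S. char_sum (u \<bullet> v))"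
    by simp
  also have "\<dots> = (\<Sum>x\<in>UNIV. \<Sum>u\<in>S. char_sum ((w \<bullet> v) * x + u \<bullet> v))"
    by (rule sum.cong[OF refl]) (rule shift)
  also have "\<dots> = (\<Sum>u\<in>S. \<Sum>x\<in>UNIV. char_sum ((w \<bullet> v) * x + u \<bullet> v))"
    by (rule sum.swap)
  also have "\<dots> = 0" using w(2) by (simp add: sum_char_sum_affine)
  finally show ?thesis using False by simp
qed

lemma dual_carrier_vec: "dual_code r (carrier_vec r) = {0\<^sub>v r :: 'a::field vec}"
proof (intro equalityI subsetI)
  fix v :: "'a vec" assume "v \<in> dual_code r (carrier_vec r)"
  then have v: "v \<in> carrier_vec r" "\<And>i. i < r \<Longrightarrow> unit_vec r i \<bullet> v = 0"
    by (auto simp: dual_code_def)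
  then have "v = 0\<^sub>v r" by (intro eq_vecI) (auto simp: scalar_prod_left_unit)
  then show "v \<in> {0\<^sub>v r}" by simp
qed (auto simp: dual_code_def)

text \<open>
  Both sides arise from summing \<open>char_sum (u \<bullet> v)\<close> over \<open>u\<close> in \<open>S\<close> and all \<open>v\<close>, in the two orders. This
  counting argument takes the place of dimension theory.
\<close>

lemma card_dual_code:
  fixes S :: "'a::{field,finite} vec set"
  assumes S: "linear_code r S"
  shows "card S * card (dual_code r S) = CARD('a) ^ r"
proof -
  let ?s = "real CARD('a)"
  have sub: "S \<subseteq> carrier_vec r" and zero: "0\<^sub>v r \<in> S" using S by (auto simp: linear_code_def)
  note fin = finite_carrier_vec[where 'a = 'a and n = r] finite_linear_code[OF S]
  have "(\<Sum>v\<in>carrier_vec r. \<Sum>u\<in>S. char_sum (u \<bullet> v))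
      = (\<Sum>v\<in>carrier_vec r. if v \<in> dual_code r S then (?s - 1) * real (card S) else 0)"
    by (rule sum.cong) (simp_all add: sum_char_sum_linear_code[OF S])
  also have "\<dots> = (?s - 1) * real (card S) * real (card (dual_code r S))"
  proof -
    have "carrier_vec r \<inter> {v. v \<in> dual_code r S} = dual_code r S" by (auto simp: dual_code_def)
    then show ?thesis using fin by (simp add: sum.If_cases)
  qed
  finally have 1: "(\<Sum>v\<in>carrier_vec r. \<Sum>u\<in>S. char_sum (u \<bullet> v)) = \<dots>" .
  have "(\<Sum>u\<in>S. \<Sum>v\<in>carrier_vec r. char_sum (u \<bullet> v))
      = (\<Sum>u\<in>S. \<Sum>v\<in>carrier_vec r. char_sum (v \<bullet> u))"
    by (intro sum.cong refl arg_cong[of _ _ char_sum] comm_scalar_prod) (use sub in auto)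
  also have "\<dots> = (\<Sum>u\<in>S. if u = 0\<^sub>v r then (?s - 1) * ?s ^ r else 0)"
    by (rule sum.cong)
       (use sub in \<open>auto simp: sum_char_sum_linear_code[OF linear_code_carrier] dual_carrier_vec
          card_carrier_vec\<close>)
  also have "\<dots> = (?s - 1) * ?s ^ r" using fin zero by simp
  finally have "(?s - 1) * (real (card S) * real (card (dual_code r S))) = (?s - 1) * ?s ^ r"
    using 1 sum.swap[of "\<lambda>u v. char_sum (u \<bullet> v)" "carrier_vec r" S] by simp
  moreover have "?s - 1 \<noteq> 0" using CARD_field_gt_1[where 'a = 'a] by simp
  ultimately have "real (card S * card (dual_code r S)) = real (CARD('a) ^ r)" by simp
  then show ?thesis by (simp only: of_nat_eq_iff)
qed

lemma dual_dual_code: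
  fixes S :: "'a::{field,finite} vec set"
  assumes S: "linear_code r S"
  shows "dual_code r (dual_code r S) = S"
proof -
  let ?D = "dual_code r S"
  have sub: "S \<subseteq> carrier_vec r" using S by (auto simp: linear_code_def)
  have D: "linear_code r ?D" by (rule linear_code_dual[OF sub])
  have DD: "linear_code r (dual_code r ?D)" by (rule linear_code_dual) (auto simp: dual_code_def)
  have "card ?D * card S = card ?D * card (dual_code r ?D)"
    using card_dual_code[OF S] card_dual_code[OF D] by (simp add: mult.commute)
  moreover have "card ?D \<noteq> 0"
    using D finite_linear_code[OF D] by (auto simp: linear_code_def)
  ultimately have "card S = card (dual_code r ?D)" by simp
  moreover have "S \<subseteq> dual_code r ?D"
  proof
    fix u assume "u \<in> S"
    then show "u \<in> dual_code r ?D"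
      using sub by (auto simp: dual_code_def) (metis comm_scalar_prod subsetD)
  qed
  ultimately show ?thesis
    using card_subset_eq[OF finite_linear_code[OF DD]] by metis
qed

lemma smult_sum_right: "Polynomial.smult c (\<Sum>i\<in>A. f i) = (\<Sum>i\<in>A. Polynomial.smult c (f i))"
  by (rule poly_eqI) (simp add: coeff_sum sum_distrib_left)

text \<open>
  Detect the condition that \<open>T w\<close> is orthogonal to \<open>S\<close> by summing \<open>char_sum (u \<bullet> T w)\<close> over \<open>u\<close> in \<open>S\<close>, move \<open>T\<close> to
  the other factor, and sum over \<open>w\<close> first. The code whose weights occur on the right consists of
  the vectors \<open>u T\<close>, each counted as often as it arises from some \<open>u\<close> in \<open>S\<close>.
\<close>

theorem MacWilliams_identity:
  fixes T :: "'a::{field,finite} mat"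
  assumes T: "T \<in> carrier_mat r n" and S: "linear_code r S"
  shows "Polynomial.smult (real (card S)) (\<Sum>w | w \<in> carrier_vec n \<and> T *\<^sub>v w \<in> dual_code r S. monom 1 (wt w))
    = (\<Sum>u\<in>S. krawtchouk_poly (real CARD('a)) n (n - wt (T\<^sup>T *\<^sub>v u)))"
proof -
  let ?s = "real CARD('a)"
  have sub: "S \<subseteq> carrier_vec r" using S by (auto simp: linear_code_def)
  have "Polynomial.smult (?s - 1) (\<Sum>u\<in>S. krawtchouk_poly ?s n (n - wt (T\<^sup>T *\<^sub>v u)))
      = (\<Sum>u\<in>S. \<Sum>w\<in>carrier_vec n. monom (char_sum ((T\<^sup>T *\<^sub>v u) \<bullet> w + 0)) (wt w))"
    unfolding smult_sum_right
  proof (rule sum.cong[OF refl])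
    fix u assume "u \<in> S"
    then have "T\<^sup>T *\<^sub>v u \<in> carrier_vec n" using T sub by auto
    from weight_enumerator_char_sum[OF this, of 0]
    show "Polynomial.smult (?s - 1) (krawtchouk_poly ?s n (n - wt (T\<^sup>T *\<^sub>v u)))
      = (\<Sum>w\<in>carrier_vec n. monom (char_sum ((T\<^sup>T *\<^sub>v u) \<bullet> w + 0)) (wt w))"
      by (simp add: char_sum_def)
  qed
  also have "\<dots> = (\<Sum>w\<in>carrier_vec n. \<Sum>u\<in>S. monom (char_sum ((T\<^sup>T *\<^sub>v u) \<bullet> w + 0)) (wt w))"
    by (rule sum.swap)
  also have "\<dots> = (\<Sum>w\<in>carrier_vec n. monom (\<Sum>u\<in>S. char_sum (u \<bullet> (T *\<^sub>v w))) (wt w))"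
    unfolding monom_sum
    by (intro sum.cong refl) (use T sub in \<open>auto simp: transpose_vec_mult_scalar\<close>)
  also have "\<dots> = (\<Sum>w\<in>carrier_vec n. if T *\<^sub>v w \<in> dual_code r S
      then Polynomial.smult ((?s - 1) * real (card S)) (monom 1 (wt w)) else 0)"
    by (intro sum.cong refl)
       (use T in \<open>auto simp: sum_char_sum_linear_code[OF S] smult_monom\<close>)
  also have "\<dots> = (\<Sum>w | w \<in> carrier_vec n \<and> T *\<^sub>v w \<in> dual_code r S.
      Polynomial.smult ((?s - 1) * real (card S)) (monom 1 (wt w)))"
    by (rule sum.inter_filter[symmetric]) (rule finite_carrier_vec)
  also have "\<dots> = Polynomial.smult (?s - 1) (Polynomial.smult (real (card S))
      (\<Sum>w | w \<in> carrier_vec n \<and> T *\<^sub>v w \<in> dual_code r S. monom 1 (wt w)))"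
    by (simp add: smult_sum_right)
  finally have "Polynomial.smult (inverse (?s - 1)) (Polynomial.smult (?s - 1)
        (\<Sum>u\<in>S. krawtchouk_poly ?s n (n - wt (T\<^sup>T *\<^sub>v u))))
      = Polynomial.smult (inverse (?s - 1)) \<dots>" by (rule arg_cong)
  moreover have "inverse (?s - 1) * (?s - 1) = 1" using CARD_field_gt_1[where 'a = 'a] by simp
  ultimately show ?thesis by (simp only: smult_smult mult.assoc[symmetric] mult_1_left smult_1_left)
qed

section \<open>Wordlength counts as weights of a dual code\<close>

definition column_code :: "'a::field mat \<Rightarrow> 'a vec set" where
  "column_code B = (\<lambda>l. B *\<^sub>v l) ` carrier_vec (dim_col B)"

lemma linear_column_code:
  assumes B: "B \<in> carrier_mat r p"
  shows "linear_code r (column_code B)"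
proof -
  have "0\<^sub>v r = B *\<^sub>v 0\<^sub>v p" using B by (auto intro!: eq_vecI)
  moreover have "B *\<^sub>v u + B *\<^sub>v v = B *\<^sub>v (u + v)" if "u \<in> carrier_vec p" "v \<in> carrier_vec p" for u v
    using mult_add_distrib_mat_vec[OF B that] by simp
  moreover have "c \<cdot>\<^sub>v (B *\<^sub>v u) = B *\<^sub>v (c \<cdot>\<^sub>v u)" if "u \<in> carrier_vec p" for c u
    using mult_mat_vec[OF B that] by simp
  ultimately show ?thesis
    using B unfolding linear_code_def column_code_def
    by (auto intro!: image_eqI mult_mat_vec_carrier)
qed

text \<open>
  The rank is the dimension of the span of the \<^emph>\<open>set\<close> of columns, so full rank must first be seen to
  exclude repeated columns.
\<close>

lemma full_column_rank_kernel_trivial: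
  fixes B :: "'a::field mat"
  assumes B: "B \<in> carrier_mat r p" and rank: "vec_space.rank r B = p"
    and v: "v \<in> carrier_vec p" "B *\<^sub>v v = 0\<^sub>v r"
  shows "v = 0\<^sub>v p"
proof -
  interpret vec_space "TYPE('a)" r .
  have distinct: "distinct (cols B)"
  proof -
    have "lin_indpt {}" by (rule finite_lin_indpt2) auto
    then obtain S where max: "maximal S (\<lambda>S. S \<subseteq> set (cols B) \<and> lin_indpt S)"
      using maximal_exists_superset[of "set (cols B)" "\<lambda>S. S \<subseteq> set (cols B) \<and> lin_indpt S" "{}"]
      by auto
    have "p = card S" using rank_card_indpt[OF B max] rank by simp
    also have "\<dots> \<le> card (set (cols B))" using max by (auto simp: maximal_def intro: card_mono)
    finally have "length (cols B) \<le> card (set (cols B))" using B by simp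
    then show ?thesis using card_length[of "cols B"] by (intro card_distinct) simp
  qed
  from full_rank_lin_indpt[OF B rank distinct] lin_depI[OF B v(1) _ v(2) distinct]
  show ?thesis by blast
qed

lemma inj_on_full_column_rank:
  fixes B :: "'a::field mat"
  assumes B: "B \<in> carrier_mat r p" and rank: "vec_space.rank r B = p"
  shows "inj_on (\<lambda>l. B *\<^sub>v l) (carrier_vec p)"
proof (rule inj_onI)
  fix u v assume u: "u \<in> carrier_vec p" and v: "v \<in> carrier_vec p" and eq: "B *\<^sub>v u = B *\<^sub>v v"
  have "B *\<^sub>v (u - v) = B *\<^sub>v u - B *\<^sub>v v" by (rule mult_minus_distrib_mat_vec[OF B u v])
  also have "\<dots> = 0\<^sub>v r" using eq B by (auto intro!: eq_vecI)
  finally have "u - v = 0\<^sub>v p"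
    by (intro full_column_rank_kernel_trivial[OF B rank]) (use u v in auto)
  then have "u $ i - v $ i = 0" if "i < p" for i
    using that u v by (metis carrier_vecD index_minus_vec(1) index_zero_vec(1))
  then show "u = v" using u v by (intro eq_vecI) auto
qed

lemma nonzero_vec_multiple_normalized:
  fixes v :: "'a::{field,finite} vec"
  assumes v: "v \<in> carrier_vec p" "v \<noteq> 0\<^sub>v p"
  obtains c l where "c \<noteq> 0" "l \<in> normalized_vecs p" "v = c \<cdot>\<^sub>v l"
proof -
  have "\<exists>i. i < p \<and> v $ i \<noteq> 0"
    using v by (metis carrier_vecD eq_vecI index_zero_vec)
  then obtain i where i: "i < p" "v $ i \<noteq> 0" and first: "\<forall>j<i. \<not> (j < p \<and> v $ j \<noteq> 0)"
    using exists_least_iff[of "\<lambda>i. i < p \<and> v $ i \<noteq> 0"] by auto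
  have "inverse (v $ i) \<cdot>\<^sub>v v \<in> normalized_vecs p"
    unfolding normalized_vecs_def using i first v(1) by (auto intro!: exI[of _ i])
  moreover have "v = v $ i \<cdot>\<^sub>v (inverse (v $ i) \<cdot>\<^sub>v v)"
    using i by (simp add: smult_smult_assoc)
  ultimately show thesis using that i(2) by blast
qed

lemma wt_1_vecs:
  "{w :: 'a::{field,finite} vec. w \<in> carrier_vec L \<and> wt w = 1}
    = (\<lambda>(c, j). c \<cdot>\<^sub>v unit_vec L j) ` ((UNIV - {0}) \<times> {..<L})"
proof (intro equalityI subsetI)
  fix w :: "'a vec" assume "w \<in> {w. w \<in> carrier_vec L \<and> wt w = 1}"
  then have w: "w \<in> carrier_vec L" "card {i. i < L \<and> w $ i \<noteq> 0} = 1" by (auto simp: wt_def)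
  then obtain j where j: "{i. i < L \<and> w $ i \<noteq> 0} = {j}" by (auto simp: card_1_singleton_iff)
  then have jL: "j < L" "w $ j \<noteq> 0" by auto
  have zero: "w $ i = 0" if "i < L" "i \<noteq> j" for i using j that by auto
  have "w = w $ j \<cdot>\<^sub>v unit_vec L j"
    using w(1) jL zero by (intro eq_vecI) auto
  then show "w \<in> (\<lambda>(c, j). c \<cdot>\<^sub>v unit_vec L j) ` ((UNIV - {0}) \<times> {..<L})"
    using jL by (intro image_eqI[of _ _ "(w $ j, j)"]) auto
next
  fix w :: "'a vec" assume "w \<in> (\<lambda>(c, j). c \<cdot>\<^sub>v unit_vec L j) ` ((UNIV - {0}) \<times> {..<L})"
  then obtain c j where w: "w = c \<cdot>\<^sub>v unit_vec L j" "c \<noteq> 0" "j < L" by auto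
  then have "{i. i < L \<and> w $ i \<noteq> 0} = {j}" by (auto split: if_splits)
  then show "w \<in> {w. w \<in> carrier_vec L \<and> wt w = 1}" using w by (simp add: wt_def)
qed

text \<open>
  A vector of weight 1 is \<open>c\<close> times a unit vector and is mapped to \<open>B (c l)\<close> for a normalized vector \<open>l\<close>;
  every nonzero vector is such a multiple \<open>c l\<close>, which gives surjectivity. Injectivity is then a matter of
  counting: both sides have \<open>s\<^sup>p - 1\<close> elements.
\<close>

lemma bij_betw_block_matrix_wt_1:
  fixes B :: "'a::{field,finite} mat"
  assumes B: "B \<in> carrier_mat r p" and rank: "vec_space.rank r B = p"
  shows "bij_betw (\<lambda>w. block_matrix B *\<^sub>v w)
    {w. w \<in> carrier_vec (dim_col (block_matrix B)) \<and> wt w = 1} (column_code B - {0\<^sub>v r})"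
proof -
  define ls :: "'a vec list" where "ls = (SOME ls. distinct ls \<and> set ls = normalized_vecs p)"
  have "distinct ls \<and> set ls = normalized_vecs p"
    unfolding ls_def
    by (rule someI_ex) (use finite_distinct_list[OF finite_normalized_vecs] in blast)
  then have ls: "distinct ls" "set ls = normalized_vecs p" by simp_all
  let ?F = "block_matrix B"
  define L where "L = length ls"
  have F: "?F = mat_of_cols r (map (\<lambda>l. B *\<^sub>v l) ls)"
    using B by (simp add: block_matrix_def ls_def)
  have FL: "?F \<in> carrier_mat r L" unfolding F L_def by auto
  have L: "L = card (normalized_vecs p :: 'a vec set)"
    using distinct_card[OF ls(1)] ls(2) by (simp add: L_def)
  have lc: "ls ! j \<in> carrier_vec p" if "j < L" for j
    using that ls(2) nth_mem[of j ls] by (auto simp: L_def normalized_vecs_def)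
  have col: "?F *\<^sub>v (c \<cdot>\<^sub>v unit_vec L j) = B *\<^sub>v (c \<cdot>\<^sub>v ls ! j)" if j: "j < L" for c j
  proof -
    have "?F *\<^sub>v unit_vec L j = B *\<^sub>v (ls ! j)"
    proof (rule eq_vecI)
      fix i assume "i < dim_vec (B *\<^sub>v (ls ! j))"
      then have i: "i < r" using B by simp
      have "row ?F i \<in> carrier_vec L" using FL by auto
      then have "(?F *\<^sub>v unit_vec L j) $ i = row ?F i $ j"
        using FL i j by (simp add: scalar_prod_right_unit)
      also have "\<dots> = (B *\<^sub>v (ls ! j)) $ i"
        unfolding F using i j by (simp add: L_def mat_of_cols_index)
      finally show "(?F *\<^sub>v unit_vec L j) $ i = (B *\<^sub>v (ls ! j)) $ i" .
    qed (use FL B in auto)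
    then show ?thesis
      using mult_mat_vec[OF FL, of "unit_vec L j"] mult_mat_vec[OF B lc[OF j]] by simp
  qed
  let ?W = "{w :: 'a vec. w \<in> carrier_vec L \<and> wt w = 1}"
  let ?C = "column_code B - {0\<^sub>v r}"
  have inj: "inj_on (\<lambda>l. B *\<^sub>v l) (carrier_vec p)" by (rule inj_on_full_column_rank[OF B rank])
  have B0: "B *\<^sub>v 0\<^sub>v p = 0\<^sub>v r" using B by (auto intro!: eq_vecI)
  have C: "?C = (\<lambda>l. B *\<^sub>v l) ` (carrier_vec p - {0\<^sub>v p})"
    using inj_on_image_set_diff[OF inj, of "carrier_vec p" "{0\<^sub>v p}"] B B0
    by (simp add: column_code_def)
  have image: "(\<lambda>w. ?F *\<^sub>v w) ` ?W = ?C"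
  proof (intro equalityI subsetI)
    fix x assume "x \<in> (\<lambda>w. ?F *\<^sub>v w) ` ?W"
    then obtain c j where cj: "c \<noteq> 0" "j < L" "x = ?F *\<^sub>v (c \<cdot>\<^sub>v unit_vec L j)"
      unfolding wt_1_vecs by auto
    have "ls ! j \<in> normalized_vecs p" using cj(2) ls(2) nth_mem[of j ls] by (simp add: L_def)
    then obtain i where "i < p" "ls ! j $ i = 1" by (auto simp: normalized_vecs_def)
    then have "(c \<cdot>\<^sub>v ls ! j) $ i \<noteq> 0\<^sub>v p $ i" using cj lc[OF cj(2)] by simp
    then have "c \<cdot>\<^sub>v ls ! j \<noteq> 0\<^sub>v p" by metis
    then show "x \<in> ?C" unfolding C cj(3) col[OF cj(2)] using lc[OF cj(2)] by auto
  next
    fix x assume "x \<in> ?C"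
    then obtain v where v: "v \<in> carrier_vec p" "v \<noteq> 0\<^sub>v p" "x = B *\<^sub>v v" unfolding C by auto
    obtain c l where cl: "c \<noteq> 0" "l \<in> normalized_vecs p" "v = c \<cdot>\<^sub>v l"
      using nonzero_vec_multiple_normalized[OF v(1,2)] .
    obtain j where j: "j < L" "l = ls ! j"
      using cl(2) unfolding L_def ls(2)[symmetric] in_set_conv_nth by blast
    have "x = ?F *\<^sub>v (c \<cdot>\<^sub>v unit_vec L j)" unfolding col[OF j(1)] using v(3) cl(3) j(2) by simp
    moreover have "c \<cdot>\<^sub>v unit_vec L j \<in> ?W"
      unfolding wt_1_vecs by (rule image_eqI[of _ _ "(c, j)"]) (use cl(1) j(1) in auto)
    ultimately show "x \<in> (\<lambda>w. ?F *\<^sub>v w) ` ?W" by (rule image_eqI)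
  qed
  have "card ?W \<le> (CARD('a) - 1) * L"
    unfolding wt_1_vecs
    by (rule order_trans[OF card_image_le])
       (simp_all add: card_cartesian_product card_Diff_singleton)
  also have "\<dots> = card ?C"
  proof -
    have "card ?C = card (carrier_vec p - {0\<^sub>v p :: 'a vec})"
      unfolding C by (rule card_image) (rule inj_on_subset[OF inj], auto)
    then show ?thesis
      using card_normalized_vecs[of p, where 'a = 'a]
      by (simp add: L card_carrier_vec card_Diff_singleton finite_carrier_vec)
  qed
  finally have "card ?W \<le> card ((\<lambda>w. ?F *\<^sub>v w) ` ?W)" unfolding image .
  moreover have fin: "finite ?W" by (rule finite_subset[OF _ finite_carrier_vec[of L]]) auto
  ultimately have "inj_on (\<lambda>w. ?F *\<^sub>v w) ?W"
    by (intro eq_card_imp_inj_on order_antisym card_image_le)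
  moreover have "dim_col ?F = L" using FL by simp
  ultimately show ?thesis using image by (simp add: bij_betw_def)
qed

text \<open>
  The second component of a pair that is counted by \<open>A1\<close> is determined by the first one, because the
  vectors of weight 1 correspond to the nonzero elements of the column space.
\<close>

lemma A1_eq:
  fixes T B :: "'a::{field,finite} mat"
  assumes T: "T \<in> carrier_mat r n"
    and B: "B \<in> carrier_mat r p" and rank: "vec_space.rank r B = p"
  shows "A1 T B i = real (card {w \<in> carrier_vec n. T *\<^sub>v w \<in> column_code B - {0\<^sub>v r} \<and> wt w = i})
    / (real CARD('a) - 1)"
proof -
  let ?F = "block_matrix B" and ?C = "column_code B - {0\<^sub>v r}"
  let ?W = "{w. w \<in> carrier_vec (dim_col ?F) \<and> wt w = 1}"
  let ?P = "{(w1, w2). w1 \<in> carrier_vec n \<and> w2 \<in> carrier_vec (dim_col ?F) \<and>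
                    T *\<^sub>v w1 + ?F *\<^sub>v w2 = 0\<^sub>v r \<and> wt w1 = i \<and> wt w2 = 1}"
  have bij: "bij_betw (\<lambda>w. ?F *\<^sub>v w) ?W ?C" by (rule bij_betw_block_matrix_wt_1[OF B rank])
  have code: "linear_code r (column_code B)" by (rule linear_column_code[OF B])
  have Cc: "v \<in> carrier_vec r" if "v \<in> column_code B" for v
    using code that by (auto simp: linear_code_def)
  have neg: "- v \<in> ?C" if "v \<in> ?C" for v
  proof -
    have v: "v \<in> carrier_vec r" using that Cc by auto
    have "(- 1) \<cdot>\<^sub>v v \<in> column_code B" using code that by (auto simp: linear_code_def)
    moreover have "(- 1) \<cdot>\<^sub>v v = - v" using v by (intro eq_vecI) auto
    moreover have "- v \<noteq> 0\<^sub>v r"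
    proof
      assume "- v = 0\<^sub>v r"
      then have "- (- v) = - 0\<^sub>v r" by simp
      then show False using that by simp
    qed
    ultimately show ?thesis by simp
  qed
  have sum0: "x + y = 0\<^sub>v r \<longleftrightarrow> x = - y" if "x \<in> carrier_vec r" "y \<in> carrier_vec r" for x y :: "'a vec"
  proof
    assume eq: "x + y = 0\<^sub>v r"
    have "x $ i + y $ i = 0" if "i < r" for i
      using arg_cong[OF eq, of "\<lambda>v. v $ i"] that \<open>y \<in> _\<close> by simp
    then show "x = - y" using that by (intro eq_vecI) (auto simp: eq_neg_iff_add_eq_0)
  qed (use that in \<open>auto intro!: eq_vecI\<close>)
  have Tc: "T *\<^sub>v w \<in> carrier_vec r" if "w \<in> carrier_vec n" for w using T that by auto
  have Fc: "?F *\<^sub>v w \<in> ?C" "?F *\<^sub>v w \<in> carrier_vec r" if "w \<in> ?W" for w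
  proof -
    show 1: "?F *\<^sub>v w \<in> ?C" by (rule bij_betw_apply[OF bij that])
    show "?F *\<^sub>v w \<in> carrier_vec r" using 1 Cc by blast
  qed
  have P: "?P = {(w1, w2). w1 \<in> carrier_vec n \<and> wt w1 = i \<and> w2 \<in> ?W \<and> T *\<^sub>v w1 = - (?F *\<^sub>v w2)}"
  proof (rule Set.set_eqI)
    fix x :: "'a vec \<times> 'a vec"
    obtain w1 w2 where x: "x = (w1, w2)" by (cases x)
    have "T *\<^sub>v w1 + ?F *\<^sub>v w2 = 0\<^sub>v r \<longleftrightarrow> T *\<^sub>v w1 = - (?F *\<^sub>v w2)"
      if "w1 \<in> carrier_vec n" "w2 \<in> ?W"
      by (rule sum0[OF Tc[OF that(1)] Fc(2)[OF that(2)]])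
    then show "x \<in> ?P \<longleftrightarrow> x \<in> {(w1, w2). w1 \<in> carrier_vec n \<and> wt w1 = i \<and> w2 \<in> ?W \<and>
        T *\<^sub>v w1 = - (?F *\<^sub>v w2)}"
      unfolding x mem_Collect_eq prod.case by blast
  qed
  have "bij_betw fst ?P {w \<in> carrier_vec n. T *\<^sub>v w \<in> ?C \<and> wt w = i}"
  proof (rule bij_betw_imageI)
    show "inj_on fst ?P"
    proof (rule inj_onI)
      fix x y assume x: "x \<in> ?P" and y: "y \<in> ?P" and xy: "fst x = fst y"
      obtain w w2 w2' where xe: "x = (w, w2)" "y = (w, w2')" using xy by (cases x, cases y) simp
      have W: "w2 \<in> ?W" "w2' \<in> ?W" and "T *\<^sub>v w = - (?F *\<^sub>v w2)" "T *\<^sub>v w = - (?F *\<^sub>v w2')"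
        using x y unfolding P xe by blast+
      then have "?F *\<^sub>v w2 = ?F *\<^sub>v w2'" by (metis uminus_uminus_vec)
      then show "x = y" using inj_onD[OF bij_betw_imp_inj_on[OF bij] _ W] xe by simp
    qed
    show "fst ` ?P = {w \<in> carrier_vec n. T *\<^sub>v w \<in> ?C \<and> wt w = i}"
    proof (intro equalityI subsetI)
      fix w assume "w \<in> fst ` ?P"
      then obtain w2 where "(w, w2) \<in> ?P" by force
      then have w: "w \<in> carrier_vec n" "wt w = i" "w2 \<in> ?W" "T *\<^sub>v w = - (?F *\<^sub>v w2)"
        unfolding P by blast+
      have "T *\<^sub>v w \<in> ?C" unfolding w(4) by (rule neg[OF Fc(1)[OF w(3)]])
      then show "w \<in> {w \<in> carrier_vec n. T *\<^sub>v w \<in> ?C \<and> wt w = i}" using w(1,2) by blast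
    next
      fix w assume "w \<in> {w \<in> carrier_vec n. T *\<^sub>v w \<in> ?C \<and> wt w = i}"
      then have w: "w \<in> carrier_vec n" "T *\<^sub>v w \<in> ?C" "wt w = i" by blast+
      have "- (T *\<^sub>v w) \<in> (\<lambda>w. ?F *\<^sub>v w) ` ?W"
        using neg[OF w(2)] bij_betw_imp_surj_on[OF bij] by simp
      then obtain w2 where w2: "w2 \<in> ?W" "- (T *\<^sub>v w) = ?F *\<^sub>v w2" by blast
      then have "T *\<^sub>v w = - (?F *\<^sub>v w2)" by (metis uminus_uminus_vec)
      then have "(w, w2) \<in> ?P" unfolding P using w(1,3) w2(1) by blast
      then show "w \<in> fst ` ?P" by (rule rev_image_eqI) simp
    qed
  qed
  from bij_betw_same_card[OF this] show ?thesis
    unfolding A1_def Let_def using T by simp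
qed

text \<open>
  The case \<open>T w = 0\<close> and the case where \<open>T w\<close> is a nonzero element of the column space add up to a condition
  of membership in a linear code, to which the MacWilliams identity applies.
\<close>

lemma A0_plus_A1_eq:
  fixes T B :: "'a::{field,finite} mat"
  assumes T: "T \<in> carrier_mat r n"
    and B: "B \<in> carrier_mat r p" and rank: "vec_space.rank r B = p"
  shows "(real CARD('a) - 1) * (A0 T i + A1 T B i)
    = coeff (\<Sum>w | w \<in> carrier_vec n \<and> T *\<^sub>v w \<in> column_code B. monom 1 (wt w)) i"
proof -
  let ?N = "\<lambda>X. {w \<in> carrier_vec n. T *\<^sub>v w \<in> X \<and> wt w = i}"
  let ?W = "{w. w \<in> carrier_vec n \<and> T *\<^sub>v w \<in> column_code B}"
  have fin: "finite ?W" by (rule finite_subset[OF _ finite_carrier_vec[of n]]) auto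
  have finN: "finite (?N X)" for X by (rule finite_subset[OF _ finite_carrier_vec[of n]]) auto
  have "0\<^sub>v r \<in> column_code B" using linear_column_code[OF B] by (simp add: linear_code_def)
  then have "?N (column_code B) = ?N {0\<^sub>v r} \<union> ?N (column_code B - {0\<^sub>v r})" by auto
  moreover have "card (?N {0\<^sub>v r} \<union> ?N (column_code B - {0\<^sub>v r}))
      = card (?N {0\<^sub>v r}) + card (?N (column_code B - {0\<^sub>v r}))"
    by (rule card_Un_disjoint[OF finN finN]) auto
  ultimately have "card (?N (column_code B))
      = card (?N {0\<^sub>v r}) + card (?N (column_code B - {0\<^sub>v r}))" by simp
  moreover have "coeff (\<Sum>w\<in>?W. monom 1 (wt w)) i = real (card (?N (column_code B)))"
  proof -
    have "coeff (\<Sum>w\<in>?W. monom (1::real) (wt w)) i = real (card {w \<in> ?W. wt w = i})"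
      using fin by (simp add: coeff_sum sum.If_cases Int_def)
    also have "{w \<in> ?W. wt w = i} = ?N (column_code B)" by auto
    finally show ?thesis .
  qed
  moreover have "real CARD('a) - 1 \<noteq> 0" using CARD_field_gt_1[where 'a = 'a] by simp
  moreover have "A0 T i = real (card (?N {0\<^sub>v r})) / (real CARD('a) - 1)"
    using T by (simp add: A0_def)
  ultimately show ?thesis
    by (simp add: A1_eq[OF T B rank] distrib_left)
qed

section \<open>Integers with prescribed mean\<close>

text \<open>
  Among integers with prescribed mean \<open>J\<close>, the excess of the sum of squares over its least value is a sum
  of products of two consecutive integers.
\<close>

lemma sum_squares_about_mean:
  fixes z :: "'b \<Rightarrow> nat"
  assumes mean: "(\<Sum>u\<in>M. real (z u)) = real (card M) * J"
  shows "(\<Sum>u\<in>M. real (z u) ^ 2) = real (card M) * (J ^ 2 + frac J * (1 - frac J))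
     + (\<Sum>u\<in>M. (real (z u) - \<lfloor>J\<rfloor>) * (real (z u) - \<lfloor>J\<rfloor> - 1))"
proof -
  define f where "f = real_of_int \<lfloor>J\<rfloor>"
  have frac: "frac J = J - f" by (simp add: frac_def f_def)
  have "(\<Sum>u\<in>M. (real (z u) - f) * (real (z u) - f - 1))
      = (\<Sum>u\<in>M. real (z u) ^ 2 - (2 * f + 1) * real (z u) + f * (f + 1))"
    by (rule sum.cong) (auto simp: algebra_simps power2_eq_square)
  also have "\<dots> = (\<Sum>u\<in>M. real (z u) ^ 2) - (2 * f + 1) * (real (card M) * J)
      + real (card M) * (f * (f + 1))"
    by (simp add: sum.distrib sum_subtractf sum_distrib_left[symmetric] mean)
  finally show ?thesis
    unfolding f_def[symmetric] frac by (simp add: algebra_simps power2_eq_square)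
qed

lemma nearest_integers_product_nonneg:
  "0 \<le> (real m - real_of_int i) * (real m - real_of_int i - 1)"
proof -
  have "0 \<le> (int m - i) * (int m - i - 1)"
    by (cases "int m \<le> i") (auto simp: zero_le_mult_iff)
  then have "0 \<le> real_of_int ((int m - i) * (int m - i - 1))" by linarith
  then show ?thesis by simp
qed

lemma sum_squares_integers_ge:
  fixes z :: "'b \<Rightarrow> nat"
  assumes "(\<Sum>u\<in>M. real (z u)) = real (card M) * J"
  shows "real (card M) * (J ^ 2 + frac J * (1 - frac J)) \<le> (\<Sum>u\<in>M. real (z u) ^ 2)"
  unfolding sum_squares_about_mean[OF assms]
  by (simp add: sum_nonneg nearest_integers_product_nonneg)

text \<open>
  When the sum of squares is minimal, every \<open>z u\<close> is \<open>f\<close> or \<open>f + 1\<close>. On these two values any \<open>P\<close>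
  agrees with its linear interpolation, so its sum depends on the mean only.
\<close>

lemma sum_function_of_integers_if_sum_squares_minimal:
  fixes z :: "'b \<Rightarrow> nat" and P :: "nat \<Rightarrow> real"
  assumes fin: "finite M" and J: "0 \<le> J"
    and mean: "(\<Sum>u\<in>M. real (z u)) = real (card M) * J"
    and min: "(\<Sum>u\<in>M. real (z u) ^ 2) = real (card M) * (J ^ 2 + frac J * (1 - frac J))"
  defines "f \<equiv> nat \<lfloor>J\<rfloor>"
  shows "(\<Sum>u\<in>M. P (z u)) = real (card M) * (P f + (J - real f) * (P (f + 1) - P f))"
proof -
  have f: "real_of_int \<lfloor>J\<rfloor> = real f" using J by (simp add: f_def)
  have z: "z u = f \<or> z u = f + 1" if "u \<in> M" for u
  proof -
    have "(\<Sum>u\<in>M. (real (z u) - \<lfloor>J\<rfloor>) * (real (z u) - \<lfloor>J\<rfloor> - 1)) = 0"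
      using sum_squares_about_mean[OF mean] min by simp
    then have "\<forall>u\<in>M. (real (z u) - \<lfloor>J\<rfloor>) * (real (z u) - \<lfloor>J\<rfloor> - 1) = 0"
      by (rule iffD1[OF sum_nonneg_eq_0_iff[OF fin nearest_integers_product_nonneg]])
    then have "(real (z u) - \<lfloor>J\<rfloor>) * (real (z u) - \<lfloor>J\<rfloor> - 1) = 0"
      using that by blast
    then show ?thesis unfolding f by auto
  qed
  have "(\<Sum>u\<in>M. P (z u)) = (\<Sum>u\<in>M. P f + (real (z u) - real f) * (P (f + 1) - P f))"
  proof (rule sum.cong)
    fix u assume "u \<in> M"
    from z[OF this] show "P (z u) = P f + (real (z u) - real f) * (P (f + 1) - P f)"
      by (elim disjE) simp_all
  qed simp
  also have "\<dots> = real (card M) * P f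
      + ((\<Sum>u\<in>M. real (z u)) - real (card M) * real f) * (P (f + 1) - P f)"
    by (simp add: sum.distrib sum_subtractf sum_distrib_right[symmetric])
  finally show ?thesis unfolding mean by (simp add: algebra_simps)
qed

section \<open>The minimal number of words of length two\<close>

text \<open>
  The value of \<open>A\<^bsub>2,1\<^esub>\<close> in an RME design whose principal block has \<open>s\<^sup>m\<close> runs, where \<open>Q\<close> is the sum over the
  nonzero runs of the squared numbers of zeros; the zero run accounts for \<open>n\<^sup>2\<close>.
\<close>

definition A21_of_sum_squares :: "real \<Rightarrow> nat \<Rightarrow> nat \<Rightarrow> real \<Rightarrow> real" where
  "A21_of_sum_squares s n m Q = inverse (2 * (s - 1)) *
     (- real n * (real n + s - 1) + s powi (2 - int m) * (real n ^ 2 + Q))"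

text \<open>
  The number \<open>J\<close> of the theorem: each column of the principal block vanishes in \<open>s\<^bsup>m-1\<^esup>\<close> runs, one of which
  is the zero run, and there are \<open>s\<^sup>m - 1\<close> other runs.
\<close>

definition mean_zeros :: "real \<Rightarrow> nat \<Rightarrow> nat \<Rightarrow> real" where
  "mean_zeros s n m = real n * (s ^ (m - 1) - 1) / (s ^ m - 1)"

text \<open>
  All that the later arguments need from an RME design. Here \<open>M\<close> is the set of nonzero \<open>u\<close> with \<open>u B = 0\<close>, and
  \<open>z u\<close> is the number of zeros of the run \<open>u T\<close>. In the MacWilliams
  identity, the vanishing coefficient of \<open>X\<close> gives the mean of \<open>z\<close>, and the coefficient of \<open>X\<^sup>2\<close> is
  \<open>(s - 1) A\<^bsub>2,1\<^esub>\<close>.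
\<close>

lemma RME_zero_counts:
  fixes T B :: "'a::{field,finite} mat"
  assumes "k < n" and RME: "RME n k p T B"
  defines "s \<equiv> real CARD('a)" and "m \<equiv> n - k - p"
  obtains M :: "'a vec set" and z :: "'a vec \<Rightarrow> nat" where
    "0 < m" "p \<le> n - k" "finite M" "real (card M) = s ^ m - 1"
    "(\<Sum>u\<in>M. real (z u)) = real (card M) * mean_zeros s n m"
    "A1 T B 2 = A21_of_sum_squares s n m (\<Sum>u\<in>M. real (z u) ^ 2)"
    "\<And>i. s ^ m * (s - 1) * (A0 T i + A1 T B i)
      = coeff (krawtchouk_poly s n n) i + (\<Sum>u\<in>M. coeff (krawtchouk_poly s n (z u)) i)"
proof -
  define r where "r = n - k"
  have T: "T \<in> carrier_mat r n" and B: "B \<in> carrier_mat r p" and rank: "vec_space.rank r B = p"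
    and A: "A0 T 1 = 0" "A0 T 2 = 0" "A1 T B 1 = 0"
    using RME by (auto simp: RME_def regular_blocked_design_def regular_design_def r_def)
  have s: "s > 1" using CARD_field_gt_1[where 'a = 'a] by (simp add: s_def)
  have code: "linear_code r (column_code B)" by (rule linear_column_code[OF B])
  then have sub: "column_code B \<subseteq> carrier_vec r" by (simp add: linear_code_def)
  define U where "U = dual_code r (column_code B)"
  define z where "z u = n - wt (T\<^sup>T *\<^sub>v u)" for u
  have U: "linear_code r U" unfolding U_def by (rule linear_code_dual[OF sub])
  have finU: "finite U" by (rule finite_linear_code[OF U])
  have zero: "0\<^sub>v r \<in> U" using U by (simp add: linear_code_def)
  have z_le: "z u \<le> n" for u by (simp add: z_def)
  have "T\<^sup>T *\<^sub>v 0\<^sub>v r = 0\<^sub>v n" using T by (auto intro!: eq_vecI)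
  moreover have "wt (0\<^sub>v n :: 'a vec) = 0" unfolding wt_def card_eq_0_iff by auto
  ultimately have z0: "z (0\<^sub>v r) = n" by (simp add: z_def)
  have "card (column_code B) = CARD('a) ^ p"
    using card_image[OF inj_on_full_column_rank[OF B rank]] B
    by (simp add: column_code_def card_carrier_vec)
  then have cardU': "CARD('a) ^ p * card U = CARD('a) ^ r"
    using card_dual_code[OF code] by (simp add: U_def)
  have "CARD('a) ^ p \<le> CARD('a) ^ p * card U" using zero finU by (auto simp: card_gt_0_iff Suc_le_eq)
  then have p_le: "p \<le> r"
    unfolding cardU' using CARD_field_gt_1[where 'a = 'a] by simp
  then have "r = p + m" by (simp add: m_def r_def)
  then have "CARD('a) ^ r = CARD('a) ^ p * CARD('a) ^ m" by (simp add: power_add)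
  with cardU' have cardU: "card U = CARD('a) ^ m" by simp
  have count: "s ^ m * (s - 1) * (A0 T i + A1 T B i) = (\<Sum>u\<in>U. coeff (krawtchouk_poly s n (z u)) i)" for i
  proof -
    have "s ^ m * (s - 1) * (A0 T i + A1 T B i) = coeff (Polynomial.smult (real (card U))
        (\<Sum>w | w \<in> carrier_vec n \<and> T *\<^sub>v w \<in> dual_code r U. monom 1 (wt w))) i"
      using A0_plus_A1_eq[OF T B rank, of i] dual_dual_code[OF code] cardU
      by (simp add: U_def s_def mult.assoc)
    also have "\<dots> = (\<Sum>u\<in>U. coeff (krawtchouk_poly s n (z u)) i)"
      unfolding MacWilliams_identity[OF T U] by (simp add: coeff_sum s_def z_def)
    finally show ?thesis .
  qed
  have "(\<Sum>u\<in>U. s * real (z u) - real n) = 0"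
    using count[of 1] A by (simp add: coeff_krawtchouk_poly(1)[OF z_le, simplified])
  then have sum_z: "s * (\<Sum>u\<in>U. real (z u)) = real n * s ^ m"
    by (simp add: sum_subtractf sum_distrib_left cardU s_def)
  \<comment> \<open>If \<open>U\<close> were trivial, its only run would be zero and could not have \<open>n / s\<close> zeros on average.\<close>
  have m: "0 < m"
  proof (rule ccontr)
    assume "\<not> 0 < m"
    then have "card U = 1" using cardU by simp
    then have "U = {0\<^sub>v r}" using zero by (auto simp: card_1_singleton_iff)
    then have "s * real n = real n" using sum_z z0 \<open>\<not> 0 < m\<close> by simp
    then show False using s \<open>k < n\<close> by simp
  qed
  then have sm: "s ^ m = s * s ^ (m - 1)" by (cases m) auto
  with sum_z s have sum_z: "(\<Sum>u\<in>U. real (z u)) = real n * s ^ (m - 1)" by simp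
  define M where "M = U - {0\<^sub>v r}"
  have split: "(\<Sum>u\<in>U. f (z u)) = f n + (\<Sum>u\<in>M. f (z u))" for f :: "nat \<Rightarrow> real"
    unfolding M_def using sum.remove[OF finU zero, of "\<lambda>u. f (z u)"] z0 by simp
  have "1 \<le> card U" using zero finU by (auto simp: card_gt_0_iff Suc_le_eq)
  then have cardM: "real (card M) = s ^ m - 1"
    unfolding M_def using zero finU by (simp add: card_Diff_singleton of_nat_diff cardU s_def)
  have sm1: "s ^ m - 1 \<noteq> 0" using one_less_power[OF s m] by simp
  show thesis
  proof (rule that)
    show "0 < m" "p \<le> n - k" "finite M" "real (card M) = s ^ m - 1"
      using m p_le finU cardM by (simp_all add: r_def M_def)
    show "(\<Sum>u\<in>M. real (z u)) = real (card M) * mean_zeros s n m"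
      using split[of real] sum_z sm1 by (simp add: mean_zeros_def cardM field_simps)
    show "s ^ m * (s - 1) * (A0 T i + A1 T B i)
      = coeff (krawtchouk_poly s n n) i + (\<Sum>u\<in>M. coeff (krawtchouk_poly s n (z u)) i)" for i
      unfolding count by (rule split)
    have "2 * (s ^ m * (s - 1) * A1 T B 2)
        = (\<Sum>u\<in>U. (s * real (z u) - real n) ^ 2 - s * (s - 2) * real (z u) - real n)"
      using count[of 2] A by (simp add: coeff_krawtchouk_poly(2)[OF z_le] sum_divide_distrib[symmetric])
    also have "\<dots> = (\<Sum>u\<in>U. s ^ 2 * real (z u) ^ 2 - (2 * s * real n + s * (s - 2)) * real (z u)
        + (real n ^ 2 - real n))"
      by (rule sum.cong) (auto simp: power2_eq_square algebra_simps)
    also have "\<dots> = s ^ 2 * (\<Sum>u\<in>U. real (z u) ^ 2)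
        - (2 * s * real n + s * (s - 2)) * (\<Sum>u\<in>U. real (z u)) + s ^ m * (real n ^ 2 - real n)"
      by (simp add: sum.distrib sum_subtractf sum_distrib_left[symmetric] cardU s_def)
    also have "\<dots> = s ^ 2 * (real n ^ 2 + (\<Sum>u\<in>M. real (z u) ^ 2))
        - s ^ m * (real n * (real n + s - 1))"
      unfolding sum_z sm split[of "\<lambda>x. real x ^ 2"] by (simp add: power2_eq_square algebra_simps)
    finally have eq: "2 * (s ^ m * (s - 1) * A1 T B 2) = \<dots>" .
    have powi: "s powi (2 - int m) = s ^ 2 / s ^ m"
      using s by (simp add: power_int_diff)
    have "s ^ m > 0" using s by simp
    with eq show "A1 T B 2 = A21_of_sum_squares s n m (\<Sum>u\<in>M. real (z u) ^ 2)"
      unfolding A21_of_sum_squares_def powi using s by (simp add: field_simps)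
  qed
qed

lemma A21_of_sum_squares_le_iff:
  assumes "1 < s"
  shows "A21_of_sum_squares s n m Q \<le> A21_of_sum_squares s n m Q' \<longleftrightarrow> Q \<le> Q'"
proof -
  have "s powi (2 - int m) > 0" using assms by simp
  then show ?thesis using assms by (simp add: A21_of_sum_squares_def)
qed

text \<open>
  The least sum of squares of \<open>s\<^sup>m - 1\<close> integers with mean \<open>J\<close>.
\<close>

definition min_sum_squares :: "real \<Rightarrow> nat \<Rightarrow> nat \<Rightarrow> real" where
  "min_sum_squares s n m = (s ^ m - 1) *
     (mean_zeros s n m ^ 2 + frac (mean_zeros s n m) * (1 - frac (mean_zeros s n m)))"

lemma A21_lower_bound:
  fixes T B :: "'a::{field,finite} mat"
  assumes "k < n" and "RME n k p T B"
  shows "A21_of_sum_squares (real CARD('a)) n (n - k - p) (min_sum_squares (real CARD('a)) n (n - k - p))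
    \<le> A1 T B 2"
proof -
  have s: "1 < real CARD('a)" using CARD_field_gt_1[where 'a = 'a] by simp
  obtain M :: "'a vec set" and z :: "'a vec \<Rightarrow> nat" where
    card: "real (card M) = real CARD('a) ^ (n - k - p) - 1"
    and mean: "(\<Sum>u\<in>M. real (z u)) = real (card M) * mean_zeros (real CARD('a)) n (n - k - p)"
    and A21: "A1 T B 2 = A21_of_sum_squares (real CARD('a)) n (n - k - p) (\<Sum>u\<in>M. real (z u) ^ 2)"
    using RME_zero_counts[OF assms] by metis
  show ?thesis
    unfolding A21 A21_of_sum_squares_le_iff[OF s] min_sum_squares_def card[symmetric]
    by (rule sum_squares_integers_ge[OF mean])
qed

text \<open>
  A minimal \<open>A\<^bsub>2,1\<^esub>\<close> forces the sum of squares of the numbers of zeros to be minimal, so each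
  coefficient of the MacWilliams identity depends on the mean \<open>J\<close> alone.
\<close>

lemma A0_plus_A1_determined_if_A21_minimal:
  fixes T B T' B' :: "'a::{field,finite} mat"
  assumes "k < n" and "RME n k p T B" "RME n k p T' B'"
    and min: "A1 T B 2
      = A21_of_sum_squares (real CARD('a)) n (n - k - p) (min_sum_squares (real CARD('a)) n (n - k - p))"
    and eq: "A1 T' B' 2 = A1 T B 2"
  shows "A0 T' i + A1 T' B' i = A0 T i + A1 T B i"
proof -
  define s where "s = real CARD('a)"
  define m where "m = n - k - p"
  let ?J = "mean_zeros s n m"
  let ?f = "nat \<lfloor>?J\<rfloor>"
  let ?K = "\<lambda>z. coeff (krawtchouk_poly s n z) i"
  have s: "1 < s" using CARD_field_gt_1[where 'a = 'a] by (simp add: s_def)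
  have "0 \<le> s ^ (m - 1) - 1" "0 \<le> s ^ m - 1" using s by (simp_all add: one_le_power)
  then have J: "0 \<le> ?J" by (simp add: mean_zeros_def)
  have determined: "s ^ m * (s - 1) * (A0 S i + A1 S C i)
      = ?K n + (s ^ m - 1) * (?K ?f + (?J - real ?f) * (?K (?f + 1) - ?K ?f))"
    if RME: "RME n k p S C" and A21: "A1 S C 2 = A1 T B 2" for S C :: "'a mat"
  proof -
    obtain M :: "'a vec set" and z :: "'a vec \<Rightarrow> nat" where
      fin: "finite M" and card: "real (card M) = s ^ m - 1"
      and mean: "(\<Sum>u\<in>M. real (z u)) = real (card M) * ?J"
      and A21': "A1 S C 2 = A21_of_sum_squares s n m (\<Sum>u\<in>M. real (z u) ^ 2)"
      and count: "s ^ m * (s - 1) * (A0 S i + A1 S C i) = ?K n + (\<Sum>u\<in>M. ?K (z u))"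
      by (rule RME_zero_counts[OF \<open>k < n\<close> RME, folded s_def m_def]) (rule that, assumption+)
    have "A21_of_sum_squares s n m (\<Sum>u\<in>M. real (z u) ^ 2)
        = A21_of_sum_squares s n m (min_sum_squares s n m)"
      using min A21 A21' by (simp add: s_def m_def)
    then have "(\<Sum>u\<in>M. real (z u) ^ 2) = min_sum_squares s n m"
      by (simp only: order_eq_iff A21_of_sum_squares_le_iff[OF s])
    then have "(\<Sum>u\<in>M. real (z u) ^ 2) = real (card M) * (?J ^ 2 + frac ?J * (1 - frac ?J))"
      by (simp add: min_sum_squares_def card)
    from sum_function_of_integers_if_sum_squares_minimal[OF fin J mean this, of ?K]
    show ?thesis unfolding count card by simp
  qed
  have "s ^ m * (s - 1) \<noteq> 0" using s by simp
  moreover have "s ^ m * (s - 1) * (A0 T' i + A1 T' B' i) = s ^ m * (s - 1) * (A0 T i + A1 T B i)"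
    using determined[OF \<open>RME n k p T' B'\<close> eq] determined[OF \<open>RME n k p T B\<close> refl] by simp
  ultimately show ?thesis by (simp only: mult_cancel_left) simp
qed

section \<open>Lexicographic comparison of wordlength sequences\<close>

lemma lex_leI:
  assumes "\<And>m. (\<And>j. j < m \<Longrightarrow> f j = g j) \<Longrightarrow> f m \<le> g m"
  shows "lex_le f g"
proof (cases "f = g")
  case False
  then obtain m where m: "f m \<noteq> g m" "\<forall>j<m. f j = g j"
    using exists_least_iff[of "\<lambda>m. f m \<noteq> g m"] by auto
  with assms[of m] have "f m < g m" by force
  with m(2) show ?thesis unfolding lex_le_def less_fun_def by blast
qed (simp add: lex_le_def)

lemma lex_leD:
  assumes "lex_le f g" "\<And>j. j < m \<Longrightarrow> f j = g j"
  shows "f m \<le> g m"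
proof (cases "f = g")
  case False
  then obtain l where l: "f l < g l" "\<And>j. j < l \<Longrightarrow> f j = g j"
    using assms(1) unfolding lex_le_def less_fun_def by blast
  then have "m \<le> l" using assms(2)[of l] by (cases "l < m") auto
  with l show ?thesis by (cases "m = l") auto
qed simp

text \<open>
  The sequences in a form without division: \<open>i\<close> counts the pairs or triples from 0, so the
  wordlength index is shifted by 2.
\<close>

lemma W_scf_unfold:
  "W_scf a b (2 * i) = a (i + 3)"
  "W_scf a b (2 * i + 1) = b (i + 2)"
  by (simp_all add: W_scf_def Let_def numeral_3_eq_3)

lemma W_cc_unfold:
  "W_cc a b (2 * i) = real ((2 * i + 3) choose (i + 2)) * a (2 * i + 3) + b (i + 2)"
  "W_cc a b (2 * i + 1) = a (2 * i + 4)"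
proof -
  have "2 * (i + 2) - 1 = 2 * i + 3" "2 * (i + 2) = 2 * i + 4"
    "2 * i div 2 + 2 = i + 2" "(2 * i + 1) div 2 + 2 = i + 2"
    "2 * i mod 2 = 0" "(2 * i + 1) mod 2 = 1" by auto
  then show "W_cc a b (2 * i) = real ((2 * i + 3) choose (i + 2)) * a (2 * i + 3) + b (i + 2)"
    "W_cc a b (2 * i + 1) = a (2 * i + 4)"
    unfolding W_cc_def Let_def by (simp_all only:) simp_all
qed

lemma div_mod_triple:
  "3 * i div 3 = (i::nat)" "(3 * i + 1) div 3 = i" "(3 * i + 2) div 3 = i"
  "3 * i mod 3 = 0" "(3 * i + 1) mod 3 = 1" "(3 * i + 2) mod 3 = 2"
  "2 * (i + 2) - 1 = 2 * i + 3" "2 * (i + 2) = 2 * i + 4"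
  by presburger+

lemma W_1_unfold:
  "W_1 a b (3 * i) = a (2 * i + 3)"
  "W_1 a b (3 * i + 1) = a (2 * i + 4)"
  "W_1 a b (3 * i + 2) = b (i + 2)"
  unfolding W_1_def Let_def div_mod_triple by (simp_all add: add.commute)

lemma W_2_unfold:
  "W_2 a b (3 * i) = a (2 * i + 3)"
  "W_2 a b (3 * i + 1) = b (i + 2)"
  "W_2 a b (3 * i + 2) = a (2 * i + 4)"
  unfolding W_2_def Let_def div_mod_triple by (simp_all add: add.commute)

text \<open>
  What is known about a design with counts \<open>a\<close>, \<open>b\<close> and a competitor with counts \<open>a'\<close>, \<open>b'\<close>.
  The comparison \<open>lex\<close> starts at index 1 while the four sequences start with \<open>a 3\<close>, which is why the
  first two counts have to agree.
\<close>

locale wordlength_comparison =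
  fixes a b a' b' :: "nat \<Rightarrow> real"
  assumes lex: "lex_le (\<lambda>i. a (Suc i)) (\<lambda>i. a' (Suc i))"
    and a_small: "a 1 = a' 1" "a 2 = a' 2"
    and b2_le: "b 2 \<le> b' 2"
    and sums_eq: "b 2 = b' 2 \<Longrightarrow> a i + b i = a' i + b' i"
begin

lemma a_le:
  assumes "\<And>j. \<lbrakk>3 \<le> j; j < i\<rbrakk> \<Longrightarrow> a j = a' j" "1 \<le> i"
  shows "a i \<le> a' i"
proof -
  have "a (Suc j) = a' (Suc j)" if "j < i - 1" for j
  proof -
    have "j = 0 \<or> j = 1 \<or> 3 \<le> Suc j" by auto
    then show ?thesis using assms(1)[of "Suc j"] that a_small by (auto simp: numeral_2_eq_2)
  qed
  from lex_leD[OF lex, of "i - 1", OF this] show ?thesis using assms(2) by simp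
qed

text \<open>
  The count \<open>b 2\<close> is minimal unconditionally; any other \<open>b i\<close> is tied as soon as \<open>b 2\<close> and \<open>a i\<close> are.
\<close>

lemma b_le:
  assumes "i \<noteq> 2 \<Longrightarrow> b 2 = b' 2" "i \<noteq> 2 \<Longrightarrow> a i = a' i"
  shows "b i \<le> b' i"
  using assms b2_le sums_eq[of i] by (cases "i = 2") auto

lemma W_scf_le: "lex_le (W_scf a b) (W_scf a' b')"
proof (rule lex_leI)
  fix m assume eq: "\<And>j. j < m \<Longrightarrow> W_scf a b j = W_scf a' b' j"
  have A: "a j = a' j" if "3 \<le> j" "2 * (j - 3) < m" for j
    using eq[OF that(2)] that(1) by (simp add: W_scf_unfold)
  have B: "b 2 = b' 2" if "1 < m"
    using eq[OF that] W_scf_unfold(2)[of _ _ 0] by (simp add: numeral_2_eq_2)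
  define q where "q = m div 2"
  show "W_scf a b m \<le> W_scf a' b' m"
  proof (cases "even m")
    case True
    then have m: "m = 2 * q" by (simp add: q_def)
    have "a (q + 3) \<le> a' (q + 3)" by (rule a_le) (auto simp: m intro!: A)
    then show ?thesis by (simp only: m W_scf_unfold)
  next
    case False
    then have m: "m = 2 * q + 1" by (simp add: q_def)
    have "b (q + 2) \<le> b' (q + 2)"
      by (rule b_le) (auto simp: m intro!: A B)
    then show ?thesis by (simp only: m W_scf_unfold)
  qed
qed

lemma W_1_le: "lex_le (W_1 a b) (W_1 a' b')"
proof (rule lex_leI)
  fix m assume eq: "\<And>j. j < m \<Longrightarrow> W_1 a b j = W_1 a' b' j"
  have odd: "a (2 * i + 3) = a' (2 * i + 3)" if "3 * i < m" for i
    using eq[OF that] unfolding W_1_unfold .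
  have even: "a (2 * i + 4) = a' (2 * i + 4)" if "3 * i + 1 < m" for i
    using eq[OF that] unfolding W_1_unfold .
  have B: "b 2 = b' 2" if "2 < m"
    using eq[OF that] W_1_unfold(3)[of _ _ 0] by (simp add: numeral_2_eq_2)
  define q where "q = m div 3"
  have A: "a j = a' j" if "3 \<le> j" "j < 2 * q + 3" for j
  proof -
    have "3 * q \<le> m" by (simp add: q_def)
    have "j = 2 * ((j - 3) div 2) + 3 \<or> j = 2 * ((j - 3) div 2) + 4"
      using that(1) by presburger
    then consider i where "j = 2 * i + 3" | i where "j = 2 * i + 4" by blast
    then show ?thesis
      using odd even that(2) \<open>3 * q \<le> m\<close> by cases auto
  qed
  have "m mod 3 = 0 \<or> m mod 3 = 1 \<or> m mod 3 = 2" by presburger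
  then consider "m = 3 * q" | "m = 3 * q + 1" | "m = 3 * q + 2"
    unfolding q_def by (metis add_0_right mult_div_mod_eq)
  then show "W_1 a b m \<le> W_1 a' b' m"
  proof cases
    case m: 1
    have "a (2 * q + 3) \<le> a' (2 * q + 3)" by (rule a_le) (auto intro: A)
    then show ?thesis by (simp only: m W_1_unfold)
  next
    case m: 2
    have "a j = a' j" if "3 \<le> j" "j < 2 * q + 4" for j
      using A[of j] odd[of q] that m by (cases "j = 2 * q + 3") auto
    then have "a (2 * q + 4) \<le> a' (2 * q + 4)" by (rule a_le) auto
    then show ?thesis by (simp only: m W_1_unfold)
  next
    case m: 3
    have "b (q + 2) \<le> b' (q + 2)" by (rule b_le) (auto simp: m intro!: A B)
    then show ?thesis by (simp only: m W_1_unfold)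
  qed
qed

lemma W_2_le: "lex_le (W_2 a b) (W_2 a' b')"
proof (rule lex_leI)
  fix m assume eq: "\<And>j. j < m \<Longrightarrow> W_2 a b j = W_2 a' b' j"
  have odd: "a (2 * i + 3) = a' (2 * i + 3)" if "3 * i < m" for i
    using eq[OF that] unfolding W_2_unfold .
  have even: "a (2 * i + 4) = a' (2 * i + 4)" if "3 * i + 2 < m" for i
    using eq[OF that] unfolding W_2_unfold .
  have B: "b 2 = b' 2" if "1 < m"
    using eq[OF that] W_2_unfold(2)[of _ _ 0] by (simp add: numeral_2_eq_2)
  define q where "q = m div 3"
  have A: "a j = a' j" if "3 \<le> j" "j < 2 * q + 3" for j
  proof -
    have "3 * q \<le> m" by (simp add: q_def)
    have "j = 2 * ((j - 3) div 2) + 3 \<or> j = 2 * ((j - 3) div 2) + 4"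
      using that(1) by presburger
    then consider i where "j = 2 * i + 3" | i where "j = 2 * i + 4" by blast
    then show ?thesis
      using odd even that(2) \<open>3 * q \<le> m\<close> by cases auto
  qed
  have "m mod 3 = 0 \<or> m mod 3 = 1 \<or> m mod 3 = 2" by presburger
  then consider "m = 3 * q" | "m = 3 * q + 1" | "m = 3 * q + 2"
    unfolding q_def by (metis add_0_right mult_div_mod_eq)
  then show "W_2 a b m \<le> W_2 a' b' m"
  proof cases
    case m: 1
    have "a (2 * q + 3) \<le> a' (2 * q + 3)" by (rule a_le) (auto intro: A)
    then show ?thesis by (simp only: m W_2_unfold)
  next
    case m: 2
    have "b (q + 2) \<le> b' (q + 2)" by (rule b_le) (auto simp: m intro!: A B)
    then show ?thesis by (simp only: m W_2_unfold)
  next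
    case m: 3
    have "a j = a' j" if "3 \<le> j" "j < 2 * q + 4" for j
      using A[of j] odd[of q] that m by (cases "j = 2 * q + 3") auto
    then have "a (2 * q + 4) \<le> a' (2 * q + 4)" by (rule a_le) auto
    then show ?thesis by (simp only: m W_2_unfold)
  qed
qed

text \<open>
  Here \<open>a\<close> and \<open>b\<close> are mixed in one entry, so a tie of entries has to be resolved into ties of counts. In the
  first entry both summands are minimal, hence both are tied. In a later entry \<open>b (i + 2)\<close> is tied because
  \<open>a (i + 2)\<close> is, by induction, and so \<open>a (2 * i + 3)\<close> is tied as well.
\<close>

lemma W_cc_le: "lex_le (W_cc a b) (W_cc a' b')"
proof (rule lex_leI)
  fix m assume eq: "\<And>j. j < m \<Longrightarrow> W_cc a b j = W_cc a' b' j"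
  have "a 3 \<le> a' 3" by (rule a_le) auto
  have mixed: "real ((2 * i + 3) choose (i + 2)) * a (2 * i + 3) + b (i + 2)
      = real ((2 * i + 3) choose (i + 2)) * a' (2 * i + 3) + b' (i + 2)" if "2 * i < m" for i
    using eq[OF that] unfolding W_cc_unfold .
  have even: "a (2 * i + 4) = a' (2 * i + 4)" if "2 * i + 1 < m" for i
    using eq[OF that] unfolding W_cc_unfold .
  have first: "a 3 = a' 3 \<and> b 2 = b' 2" if "0 < m"
  proof -
    have "3 * a 3 + b 2 = 3 * a' 3 + b' 2"
      using mixed[of 0] that by (simp add: numeral_3_eq_3 numeral_2_eq_2)
    then show ?thesis using \<open>a 3 \<le> a' 3\<close> b2_le by linarith
  qed
  have A: "a j = a' j" if "3 \<le> j" "j - 3 < m" for j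
    using that
  proof (induction j rule: less_induct)
    case (less j)
    show ?case
    proof (cases "even j")
      case True
      then have "j = 2 * ((j - 4) div 2) + 4" using less.prems(1) by presburger
      then show ?thesis using even[of "(j - 4) div 2"] less.prems by simp
    next
      case False
      define i where "i = (j - 3) div 2"
      have j: "j = 2 * i + 3" using less.prems(1) False unfolding i_def by presburger
      show ?thesis
      proof (cases "i = 0")
        case True
        then show ?thesis using first less.prems j by simp
      next
        case False
        have "a (i + 2) = a' (i + 2)"
          by (rule less.IH) (use False less.prems j in auto)
        then have "b (i + 2) = b' (i + 2)"
          using first less.prems sums_eq[of "i + 2"] by simp
        moreover have "real ((2 * i + 3) choose (i + 2)) \<noteq> 0" by simp
        ultimately show ?thesis using mixed[of i] less.prems(2) unfolding j by simp
      qed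
    qed
  qed
  define q where "q = m div 2"
  show "W_cc a b m \<le> W_cc a' b' m"
  proof (cases "even m")
    case True
    then have m: "m = 2 * q" by (simp add: q_def)
    have "a (2 * q + 3) \<le> a' (2 * q + 3)" by (rule a_le) (auto simp: m intro!: A)
    moreover have "b (q + 2) \<le> b' (q + 2)"
      by (rule b_le) (use first in \<open>auto simp: m intro!: A\<close>)
    ultimately show ?thesis
      unfolding m W_cc_unfold by (intro add_mono mult_left_mono) simp_all
  next
    case False
    then have m: "m = 2 * q + 1" by (simp add: q_def)
    have "a (2 * q + 4) \<le> a' (2 * q + 4)" by (rule a_le) (auto simp: m intro!: A)
    then show ?thesis by (simp only: m W_cc_unfold)
  qed
qed

end

section \<open>Minimum aberration of the blocked design\<close>

theorem theorem3:
  fixes T B :: "'a::{field,finite} mat"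
    and n k p :: nat
    and s J \<eta> :: real
  assumes "k < n" and "p \<ge> 1"
    and "s = real CARD('a)"
    and "J = real n * (s powi (int n - int k - int p - 1) - 1)
               / (s powi (int n - int k - int p) - 1)"
    and "\<eta> = frac J"
    and "RME n k p T B"
    and "MA_unblocked n k T"
    and "A1 T B 2 =
           inverse (2 * (s - 1)) *
             (- real n * (real n + s - 1)
              + s powi (- (int n - int k - int p - 2)) *
                  (real n ^ 2
                   + (s powi (int n - int k - int p) - 1) * (J ^ 2 + \<eta> * (1 - \<eta>))))"
  shows "MA_blocked W_scf n k p T B \<and> MA_blocked W_1 n k p T B \<and>
         MA_blocked W_2 n k p T B \<and> MA_blocked W_cc n k p T B"
proof -
  note RME = \<open>RME n k p T B\<close>
  define m where "m = n - k - p"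
  have m: "0 < m" and p: "p \<le> n - k"
    using RME_zero_counts[OF \<open>k < n\<close> RME] unfolding m_def by metis+
  then have int_m: "int n - int k - int p = int m" "int m - 1 = int (m - 1)"
    using \<open>k < n\<close> by (auto simp: m_def)
  have J: "J = mean_zeros s n m"
    using assms(4) unfolding int_m power_int_of_nat mean_zeros_def .
  have min: "A1 T B 2 = A21_of_sum_squares s n m (min_sum_squares s n m)"
    using assms(8) unfolding int_m power_int_of_nat assms(5) J A21_of_sum_squares_def min_sum_squares_def
    by simp
  have cmp: "wordlength_comparison (A0 T) (A1 T B) (A0 T') (A1 T' B')"
    if RME': "RME n k p T' B'" for T' B' :: "'a mat"
  proof
    have "regular_design n k T'" using RME' by (simp add: RME_def regular_blocked_design_def)
    then show "lex_le (\<lambda>i. A0 T (Suc i)) (\<lambda>i. A0 T' (Suc i))"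
      using \<open>MA_unblocked n k T\<close> by (simp add: MA_unblocked_def)
    show "A0 T 1 = A0 T' 1" "A0 T 2 = A0 T' 2"
      using RME RME' by (simp_all add: RME_def)
    show "A1 T B 2 \<le> A1 T' B' 2"
      using A21_lower_bound[OF \<open>k < n\<close> RME'] min by (simp add: \<open>s = _\<close> m_def)
    show "A0 T i + A1 T B i = A0 T' i + A1 T' B' i" if "A1 T B 2 = A1 T' B' 2" for i
      using A0_plus_A1_determined_if_A21_minimal[OF \<open>k < n\<close> RME RME', of i] min that
      by (simp add: \<open>s = _\<close> m_def)
  qed
  show ?thesis
    unfolding MA_blocked_def
    using RME wordlength_comparison.W_scf_le[OF cmp] wordlength_comparison.W_1_le[OF cmp]
      wordlength_comparison.W_2_le[OF cmp] wordlength_comparison.W_cc_le[OF cmp]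
    by blast
qed

end
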